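(* For every odd prime $p$, the small Davenport constant of the Heisenberg group $H_{p^3}=\mathrm{UT}_3(\mathbb F_p)$ is $$\mathsf d(H_{p^3})=3p-3.$$
   Context: $H_{p^3}=\mathrm{UT}_3(\mathbb F_p)$ is the group of matrices $M(a,b,c)=\begin{pmatrix}1&a&c\\0&1&b\\0&0&1\end{pmatrix}$ with $a,b,c\in\mathbb F_p$, with multiplication $M(a,b,c)M(a',b',c')=M(a+a',b+b',c+c'+ab')$. For a finite group $G$, a sequence over $G$ is a finite unordered list of elements of $G$, with repetitions allowed (a finite multiset). A nonempty subsequence is product-one if its terms can be ordered so that their product (in that order) is the identity. A sequence is product-one-free if it has no nonempty product-one subsequence. The small Davenport constant $\mathsf d(G)$ is the maximum length (number of terms counted with multiplicity) of a product-one-free sequence over $G$. *)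

theory Defs
  imports
    "HOL-Analysis.Cartesian_Space"
    "HOL-Number_Theory.Residues"
    "HOL-Library.Multiset"
    "HOL-Library.Numeral_Type"
begin

section \<open>Upper unitriangular matrices of size three over a ring\<close>

text \<open>
  In the index type \<open>3\<close> the numeral \<open>3\<close> denotes the same element as \<open>0\<close>;
  the three indices are \<open>1, 2, 3\<close>.
\<close>

definition UT3_mat :: "('a, 'm) ring_scheme \<Rightarrow> 'a \<Rightarrow> 'a \<Rightarrow> 'a \<Rightarrow> 'a ^ 3 ^ 3" where
  "UT3_mat R a b c = (\<chi> i j.
     if i = j then \<one>\<^bsub>R\<^esub>
     else if i = 1 \<and> j = 2 then a
     else if i = 2 \<and> j = 3 then b
     else if i = 1 \<and> j = 3 then c
     else \<zero>\<^bsub>R\<^esub>)"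

text \<open>
  The library product \<open>**\<close> uses the type class operations of the entry type,
  so the matrix product with respect to the operations of \<open>R\<close> is written out here.
\<close>

definition mat3_mult :: "('a, 'm) ring_scheme \<Rightarrow> 'a ^ 3 ^ 3 \<Rightarrow> 'a ^ 3 ^ 3 \<Rightarrow> 'a ^ 3 ^ 3" where
  "mat3_mult R A B = (\<chi> i j. \<Oplus>\<^bsub>R\<^esub>k\<in>UNIV. A $ i $ k \<otimes>\<^bsub>R\<^esub> B $ k $ j)"

definition UT3 :: "('a, 'm) ring_scheme \<Rightarrow> ('a ^ 3 ^ 3) monoid" where
  "UT3 R = \<lparr>carrier = {UT3_mat R a b c | a b c. a \<in> carrier R \<and> b \<in> carrier R \<and> c \<in> carrier R},
            monoid.mult = mat3_mult R,
            one = UT3_mat R \<zero>\<^bsub>R\<^esub> \<zero>\<^bsub>R\<^esub> \<zero>\<^bsub>R\<^esub>\<rparr>"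

definition heisenberg :: "nat \<Rightarrow> (int ^ 3 ^ 3) monoid" where
  "heisenberg p = UT3 (residue_ring (int p))"

lemma distinct_3:
  "(1::3) \<noteq> 2" "(2::3) \<noteq> 1" "(1::3) \<noteq> 3" "(3::3) \<noteq> 1" "(2::3) \<noteq> 3" "(3::3) \<noteq> 2"
  by simp_all

lemma (in cring) UT3_mat_mult:
  assumes "a \<in> carrier R" "b \<in> carrier R" "c \<in> carrier R"
    and "a' \<in> carrier R" "b' \<in> carrier R" "c' \<in> carrier R"
  shows "mat3_mult R (UT3_mat R a b c) (UT3_mat R a' b' c') =
         UT3_mat R (a \<oplus> a') (b \<oplus> b') (c \<oplus> c' \<oplus> a \<otimes> b')"
proof -
  have fs: "(\<Oplus>k\<in>(UNIV :: 3 set). f k) = f 1 \<oplus> (f 2 \<oplus> f 3)"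
    if "\<And>k. f k \<in> carrier R" for f :: "3 \<Rightarrow> 'a"
  proof -
    have "(\<Oplus>k\<in>insert 1 (insert 2 (insert 3 ({} :: 3 set))). f k) = f 1 \<oplus> (f 2 \<oplus> (f 3 \<oplus> \<zero>))"
      using that distinct_3 by (subst finsum_insert, simp, simp, simp, simp)+ simp
    then show ?thesis using that by (simp only: UNIV_3 r_zero)
  qed
  have cl: "UT3_mat R a b c $ i $ j \<in> carrier R" "UT3_mat R a' b' c' $ i $ j \<in> carrier R" for i j
    using assms by (auto simp: UT3_mat_def)
  have "mat3_mult R (UT3_mat R a b c) (UT3_mat R a' b' c') $ i $ j =
        UT3_mat R (a \<oplus> a') (b \<oplus> b') (c \<oplus> c' \<oplus> a \<otimes> b') $ i $ j" for i j
  proof -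
    have "mat3_mult R (UT3_mat R a b c) (UT3_mat R a' b' c') $ i $ j =
      UT3_mat R a b c $ i $ 1 \<otimes> UT3_mat R a' b' c' $ 1 $ j \<oplus>
      (UT3_mat R a b c $ i $ 2 \<otimes> UT3_mat R a' b' c' $ 2 $ j \<oplus>
       UT3_mat R a b c $ i $ 3 \<otimes> UT3_mat R a' b' c' $ 3 $ j)"
      using cl by (simp add: mat3_mult_def fs)
    then show ?thesis
      using exhaust_3[of i] exhaust_3[of j] assms
      by (elim disjE) (simp_all add: UT3_mat_def distinct_3 a_ac)
  qed
  then show ?thesis
    by (simp add: vec_eq_iff)
qed

lemma (in cring) group_UT3: "group (UT3 R)"
proof (rule groupI)
  fix x assume "x \<in> carrier (UT3 R)"
  then obtain a b c where x: "x = UT3_mat R a b c" "a \<in> carrier R" "b \<in> carrier R" "c \<in> carrier R"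
    by (auto simp: UT3_def)
  show "\<one>\<^bsub>UT3 R\<^esub> \<otimes>\<^bsub>UT3 R\<^esub> x = x"
    using x by (simp add: UT3_def UT3_mat_mult)
  have "UT3_mat R (\<ominus> a) (\<ominus> b) (\<ominus> c \<oplus> a \<otimes> b) \<otimes>\<^bsub>UT3 R\<^esub> x = \<one>\<^bsub>UT3 R\<^esub>"
    using x by (simp add: UT3_def UT3_mat_mult l_neg l_minus r_neg a_ac)
  moreover have "UT3_mat R (\<ominus> a) (\<ominus> b) (\<ominus> c \<oplus> a \<otimes> b) \<in> carrier (UT3 R)"
    using x by (fastforce simp: UT3_def)
  ultimately show "\<exists>y\<in>carrier (UT3 R). y \<otimes>\<^bsub>UT3 R\<^esub> x = \<one>\<^bsub>UT3 R\<^esub>"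
    by blast
next
  fix x y assume "x \<in> carrier (UT3 R)" "y \<in> carrier (UT3 R)"
  then show "x \<otimes>\<^bsub>UT3 R\<^esub> y \<in> carrier (UT3 R)"
    unfolding UT3_def by (clarsimp simp: UT3_mat_mult) blast
next
  fix x y z assume "x \<in> carrier (UT3 R)" "y \<in> carrier (UT3 R)" "z \<in> carrier (UT3 R)"
  then show "x \<otimes>\<^bsub>UT3 R\<^esub> y \<otimes>\<^bsub>UT3 R\<^esub> z = x \<otimes>\<^bsub>UT3 R\<^esub> (y \<otimes>\<^bsub>UT3 R\<^esub> z)"
    by (auto simp: UT3_def UT3_mat_mult l_distr r_distr a_ac)
next
  show "\<one>\<^bsub>UT3 R\<^esub> \<in> carrier (UT3 R)"
    by (auto simp: UT3_def)
qed

lemma group_heisenberg: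
  assumes "p > 1"
  shows "group (heisenberg p)"
proof -
  interpret residues "int p" "residue_ring (int p)"
    using assms by unfold_locales simp_all
  show ?thesis
    unfolding heisenberg_def by (rule group_UT3)
qed

lemma finite_heisenberg: "finite (carrier (heisenberg p))"
proof -
  have "carrier (heisenberg p) \<subseteq>
    (\<lambda>(a, b, c). UT3_mat (residue_ring (int p)) a b c) `
      ({0..int p - 1} \<times> {0..int p - 1} \<times> {0..int p - 1})"
    unfolding heisenberg_def UT3_def by (force simp: residue_ring_def)
  then show ?thesis by (rule finite_subset) simp
qed


section \<open>Product-one sequences and the small Davenport constant\<close>

definition product_one :: "('a, 'm) monoid_scheme \<Rightarrow> 'a multiset \<Rightarrow> bool" where
  "product_one G T \<longleftrightarrow> (\<exists>xs. mset xs = T \<and> foldr (\<otimes>\<^bsub>G\<^esub>) xs \<one>\<^bsub>G\<^esub> = \<one>\<^bsub>G\<^esub>)"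

definition product_one_free :: "('a, 'm) monoid_scheme \<Rightarrow> 'a multiset \<Rightarrow> bool" where
  "product_one_free G S \<longleftrightarrow> \<not> (\<exists>T. T \<subseteq># S \<and> T \<noteq> {#} \<and> product_one G T)"

text \<open>
  The maximum is meaningful for finite groups: the set of lengths is nonempty and finite
  by the lemmas below.
\<close>

definition small_davenport :: "('a, 'm) monoid_scheme \<Rightarrow> nat" where
  "small_davenport G = Max {size S | S. set_mset S \<subseteq> carrier G \<and> product_one_free G S}"

lemma product_one_free_empty: "product_one_free G {#}"
  by (simp add: product_one_free_def)

lemma (in group) product_one_free_size_less:
  assumes fin: "finite (carrier G)" and S: "set_mset S \<subseteq> carrier G" and free: "product_one_free G S"
  shows "size S < card (carrier G)"
proof (rule ccontr)
  assume *: "\<not> size S < card (carrier G)"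
  obtain xs where xs: "mset xs = S" using ex_mset by blast
  define P where "P = (\<lambda>ys. foldr (\<otimes>) ys \<one>)"
  have P_closed: "P ys \<in> carrier G" if "set ys \<subseteq> carrier G" for ys
    using that unfolding P_def by (induction ys) auto
  have P_append: "P (ys @ zs) = P ys \<otimes> P zs" if "set ys \<subseteq> carrier G" "set zs \<subseteq> carrier G" for ys zs
    using that
  proof (induction ys)
    case Nil
    then show ?case using P_closed[of zs] by (simp add: P_def)
  next
    case (Cons y ys)
    then show ?case using P_closed[of zs] P_closed[of ys] by (simp add: P_def m_assoc)
  qed
  have sub: "set xs \<subseteq> carrier G" using S xs by auto
  have take_sub: "set (take n xs) \<subseteq> carrier G" for n
    using sub set_take_subset[of n xs] by blast
  have "(\<lambda>n. P (take n xs)) ` {..size S} \<subseteq> carrier G"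
    using P_closed[OF take_sub] by auto
  then have "card ((\<lambda>n. P (take n xs)) ` {..size S}) \<le> card (carrier G)"
    by (rule card_mono[OF fin])
  also have "\<dots> < card {..size S}" using * by simp
  finally have "\<not> inj_on (\<lambda>n. P (take n xs)) {..size S}"
    by (rule pigeonhole)
  then obtain i' j' where ij': "i' \<le> size S" "j' \<le> size S" "i' \<noteq> j'"
      "P (take i' xs) = P (take j' xs)"
    by (auto simp: inj_on_def)
  define i j where "i = min i' j'" and "j = max i' j'"
  have ij: "i < j" "j \<le> size S" "P (take i xs) = P (take j xs)"
    using ij' by (auto simp: i_def j_def min_def max_def)
  define zs where "zs = drop i (take j xs)"
  have "take j xs = take i (take j xs) @ zs"
    by (simp only: zs_def append_take_drop_id)
  then have split: "take j xs = take i xs @ zs"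
    using ij(1) by (simp add: min_absorb1)
  have zs_sub: "set zs \<subseteq> carrier G"
    using take_sub[of j] unfolding split by simp
  have "P (take i xs) \<otimes> P zs = P (take i xs)"
    using ij(3) split P_append[OF take_sub zs_sub] by simp
  then have "P zs = \<one>"
    using P_closed[OF take_sub[of i]] P_closed[OF zs_sub] by simp
  then have "product_one G (mset zs)"
    unfolding product_one_def P_def by blast
  moreover have "mset zs \<noteq> {#}"
    using ij xs by (auto simp: zs_def)
  moreover have "mset zs \<subseteq># S"
  proof -
    have "mset (take j xs) + mset (drop j xs) = mset xs"
      by (simp only: mset_append[symmetric] append_take_drop_id)
    then have "S = mset zs + (mset (take i xs) + mset (drop j xs))"
      unfolding split xs by (simp add: ac_simps)
    then show ?thesis
      by (simp only: mset_subset_eq_add_left)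
  qed
  ultimately show False
    using free unfolding product_one_free_def by blast
qed

lemma (in group) finite_product_one_free_sizes:
  assumes "finite (carrier G)"
  shows "finite {size S | S. set_mset S \<subseteq> carrier G \<and> product_one_free G S}"
proof (rule finite_subset)
  show "{size S | S. set_mset S \<subseteq> carrier G \<and> product_one_free G S} \<subseteq> {..<card (carrier G)}"
    by (rule subsetI, elim CollectE exE conjE)
      (simp only: lessThan_iff product_one_free_size_less[OF assms])
qed simp

end

theory Submission imports Defs begin

text \<open>
  Write a term of a sequence over the Heisenberg group as a pair \<open>(v, c)\<close>: the vector \<open>v\<close> is its
  image in the plane of pairs modulo \<open>p\<close> (the quotient by the centre), and \<open>c\<close> is the corner
  entry of the matrix.  The lower bound is the sequence that consists of \<open>p - 1\<close> copies each of two
  noncommuting generators and of a generator of the centre.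

  For the upper bound, a set of terms has a central product exactly if its vectors sum to zero, and
  then its different orderings give different central elements, called heights below.  The proof
  balances two effects.

  Growth of heights.  If the vector of a new term is not parallel to the sum of the vectors already
  used, then putting the term first or last gives products that differ by a nonzero central
  element, so the number of heights grows by at least one until it reaches \<open>p\<close>
  (\<open>card_heights_insert\<close>); a nontrivial central term, used or left out, has the same effect
  (\<open>card_heights_null\<close>).  Hence if \<open>p - 1 - s\<close> of the \<open>3 p - 2\<close> terms are central, a product-one
  subsequence exists as soon as some set \<open>B\<close> of noncentral terms has \<open>s + 1\<close> heights and the other
  noncentral terms contain a set whose vectors sum to the negative of the sum over \<open>B\<close>
  (\<open>few_heights\<close>).  Spending \<open>s + 1\<close> terms on \<open>B\<close> leaves exactly \<open>2 p - 2\<close> vectors, and these have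
  to be chosen so that their subset sums cover the plane.

  Covering the plane.  If some line through the origin carries at least \<open>p\<close> noncentral terms, then
  in a product-one-free sequence at least \<open>p\<close> noncentral terms lie off the line, because terms on the line generate with the
  centre an abelian group of order \<open>p\<^sup>2\<close>, to which Olson's theorem applies (\<open>card_line\<close>).  One
  then takes for \<open>B\<close> all but \<open>p - 1\<close> terms on the line and all but \<open>p - 1\<close> terms off it
  (\<open>heavy_line_chain\<close>); the others cover the plane coordinate by coordinate.  If no line is that
  rich, \<open>s\<close> terms of \<open>B\<close> are found greedily, and the last one is provided by
  \<open>ex_covering_complement\<close>, the heart of the proof.  It works in the group ring of the plane over
  the field with \<open>p\<close> elements, where the product of \<open>1 - X\<^sup>v\<close> over the vectors \<open>v\<close> of a set vanishes
  once the set has \<open>2 p - 1\<close> elements.  For a largest set with nonvanishing product, each vector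
  left over is a period of the coefficient function of the product.  Two independent periods make
  that function a nonzero constant, and then every vector is a subset sum.  If all vectors left
  over lie on one line, a derivation of the group ring shows that one of them can be exchanged
  for a vector off that line (\<open>exchange\<close>).
\<close>

section \<open>Signed sums over subsets\<close>

text \<open>
  Adding or removing a fixed element of \<open>R - Y\<close> pairs the sets of even with those of odd cardinality.
\<close>

lemma sum_interval_sign:
  assumes "finite R" "Y \<subseteq> R" "Y \<noteq> R"
  shows "(\<Sum>X | Y \<subseteq> X \<and> X \<subseteq> R. (-1::int) ^ card X) = 0"
proof -
  obtain r where r: "r \<in> R" "r \<notin> Y" using assms by blast
  define A where "A = {X. Y \<subseteq> X \<and> X \<subseteq> R - {r}}"
  have fin: "finite A" by (rule finite_subset[of _ "Pow R"]) (auto simp: A_def assms)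
  have "{X. Y \<subseteq> X \<and> X \<subseteq> R} = A \<union> insert r ` A"
  proof
    show "{X. Y \<subseteq> X \<and> X \<subseteq> R} \<subseteq> A \<union> insert r ` A"
    proof
      fix X assume X: "X \<in> {X. Y \<subseteq> X \<and> X \<subseteq> R}"
      show "X \<in> A \<union> insert r ` A"
      proof (cases "r \<in> X")
        case True
        then have "X = insert r (X - {r})" by auto
        moreover have "X - {r} \<in> A" using X r by (auto simp: A_def)
        ultimately show ?thesis by blast
      next
        case False
        then show ?thesis using X by (auto simp: A_def)
      qed
    qed
  qed (use r in \<open>auto simp: A_def\<close>)
  moreover have "A \<inter> insert r ` A = {}" by (auto simp: A_def)
  moreover have "inj_on (insert r) A"
    by (rule inj_onI) (auto simp: A_def)
  moreover have "(-1::int) ^ card (insert r X) = - ((-1) ^ card X)" if "X \<in> A" for X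
    using that finite_subset[of X R] assms(1) by (subst card_insert_disjoint) (auto simp: A_def)
  ultimately show ?thesis
    using fin by (simp add: sum.union_disjoint sum.reindex sum_negf)
qed

text \<open>
  Multiplying out the product, each factor contributes a constant or forces one more index to lie
  in \<open>X\<close>.  With fewer factors than indices some index stays free, and toggling it flips the sign.
  The set \<open>Y\<close> records the indices forced so far, which is what the induction on the number of
  factors needs.
\<close>

lemma signed_sum_prod_linear_zero:
  fixes c :: "'t \<Rightarrow> int" and w :: "'t \<Rightarrow> 'i \<Rightarrow> int"
  assumes "finite D" "finite R" "Y \<subseteq> R" "card D + card Y < card R"
  shows "(\<Sum>X | Y \<subseteq> X \<and> X \<subseteq> R. (-1) ^ card X * (\<Prod>t\<in>D. c t + (\<Sum>i\<in>X. w t i))) = 0"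
  using assms
proof (induction D arbitrary: Y rule: finite_induct)
  case empty
  then show ?case using sum_interval_sign[of R Y] by auto
next
  case (insert t D)
  define I where "I = {X. Y \<subseteq> X \<and> X \<subseteq> R}"
  define q where "q X = (-1) ^ card X * (\<Prod>t\<in>D. c t + (\<Sum>i\<in>X. w t i))" for X
  have fin: "finite I" by (rule finite_subset[of _ "Pow R"]) (auto simp: I_def insert)
  have step: "(\<Sum>X\<in>I. if i \<in> X then q X else 0) = 0" if i: "i \<in> R" for i
  proof -
    have "(\<Sum>X\<in>I. if i \<in> X then q X else 0) = (\<Sum>X \<in> {X \<in> I. i \<in> X}. q X)"
      using fin by (simp add: sum.inter_filter)
    also have "{X \<in> I. i \<in> X} = {X. insert i Y \<subseteq> X \<and> X \<subseteq> R}"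
      by (auto simp: I_def)
    also have "(\<Sum>X\<in>\<dots>. q X) = 0"
      unfolding q_def
    proof (rule insert.IH)
      show "insert i Y \<subseteq> R" using i insert.prems by simp
      have "card (insert i Y) \<le> Suc (card Y)" by (rule card_insert_le_m1) simp_all
      then show "card D + card (insert i Y) < card R"
        using insert by simp
    qed (fact insert.prems)
    finally show ?thesis .
  qed
  have "(\<Sum>X\<in>I. q X) = 0"
    unfolding q_def I_def using insert by (intro insert.IH) auto
  then have c0: "(\<Sum>X\<in>I. c t * q X) = 0"
    by (simp add: sum_distrib_left[symmetric])
  have "(\<Sum>X\<in>I. (\<Sum>i\<in>X. w t i) * q X) = (\<Sum>X\<in>I. \<Sum>i\<in>R. w t i * (if i \<in> X then q X else 0))"
  proof (rule sum.cong)
    fix X assume "X \<in> I"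
    then have X: "X = {i \<in> R. i \<in> X}" by (auto simp: I_def)
    have "(\<Sum>i\<in>X. w t i) * q X = (\<Sum>i\<in>X. w t i * q X)" by (rule sum_distrib_right)
    also have "\<dots> = (\<Sum>i\<in>R. if i \<in> X then w t i * q X else 0)"
      by (subst X) (rule sum.inter_filter[OF insert.prems(1)])
    also have "\<dots> = (\<Sum>i\<in>R. w t i * (if i \<in> X then q X else 0))"
      by (rule sum.cong) auto
    finally show "(\<Sum>i\<in>X. w t i) * q X = (\<Sum>i\<in>R. w t i * (if i \<in> X then q X else 0))" .
  qed simp
  also have "\<dots> = (\<Sum>i\<in>R. w t i * (\<Sum>X\<in>I. if i \<in> X then q X else 0))"
    by (subst sum.swap) (simp add: sum_distrib_left)
  also have "\<dots> = 0" using step by simp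
  finally have "(\<Sum>X\<in>I. (\<Sum>i\<in>X. w t i) * q X) = 0" .
  moreover have "(\<Sum>X\<in>I. (-1) ^ card X * (\<Prod>t\<in>insert t D. c t + (\<Sum>i\<in>X. w t i)))
      = (\<Sum>X\<in>I. c t * q X) + (\<Sum>X\<in>I. (\<Sum>i\<in>X. w t i) * q X)"
    unfolding sum.distrib[symmetric] using insert.hyps
    by (intro sum.cong) (simp_all add: q_def algebra_simps)
  ultimately show ?case using c0 by (simp add: I_def)
qed

lemma sum_Pow_insert:
  assumes "finite R" "r \<notin> R"
  shows "(\<Sum>X\<in>Pow (insert r R). f X) = (\<Sum>X\<in>Pow R. f X) + (\<Sum>X\<in>Pow R. f (insert r X) :: int)"
proof -
  have "inj_on (insert r) (Pow R)"
    using assms(2) by (intro inj_onI) (metis PowD insert_ident subsetD)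
  moreover have "Pow R \<inter> insert r ` Pow R = {}" using assms(2) by auto
  ultimately show ?thesis
    using assms by (simp add: Pow_insert sum.union_disjoint sum.reindex)
qed

section \<open>The plane modulo a prime\<close>

text \<open>
  Vectors are pairs of integers and all statements about them are modulo \<open>p\<close>; this avoids a
  type of residues depending on \<open>p\<close>.
\<close>

locale prime_modulus =
  fixes p :: nat
  assumes prime_p: "prime p"
begin

lemma p_gt_1: "p > 1"
  using prime_p prime_gt_1_nat by blast

lemma prime_int_p: "prime (int p)"
  using prime_p by simp

lemma dvd_mult_iff: "int p dvd x * y \<longleftrightarrow> int p dvd x \<or> int p dvd y"
  by (rule prime_dvd_mult_iff[OF prime_int_p])

lemma not_dvd_of_nat: "0 < n \<Longrightarrow> n < p \<Longrightarrow> \<not> int p dvd int n"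
  using nat_dvd_not_less by (auto simp: int_dvd_int_iff)

definition null :: "int \<times> int \<Rightarrow> bool" where
  "null v \<longleftrightarrow> int p dvd fst v \<and> int p dvd snd v"

definition det :: "int \<times> int \<Rightarrow> int \<times> int \<Rightarrow> int" where
  "det u v = fst u * snd v - snd u * fst v"

definition parallel :: "int \<times> int \<Rightarrow> int \<times> int \<Rightarrow> bool" where
  "parallel u v \<longleftrightarrow> int p dvd det u v"

lemma null_add: "null u \<Longrightarrow> null v \<Longrightarrow> null (u + v)"
  by (simp add: null_def)

lemma null_minus: "null (- u) \<longleftrightarrow> null u"
  by (simp add: null_def)

lemma null_shift:
  assumes "null w"
  shows "null (u - (v - w)) \<longleftrightarrow> null (u - v)"
proof -
  have "u - (v - w) = (u - v) + w" by simp
  then show ?thesis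
    using assms by (simp only: null_def fst_add snd_add) (simp add: dvd_add_left_iff)
qed

lemma det_add_left: "det (u + v) w = det u w + det v w"
  by (simp add: det_def algebra_simps)

lemma det_add_right: "det u (v + w) = det u v + det u w"
  by (simp add: det_def algebra_simps)

lemma det_zero [simp]: "det 0 v = 0" "det v 0 = 0"
  by (simp_all add: det_def)

lemma det_sum_right: "det u (\<Sum>i\<in>X. g i) = (\<Sum>i\<in>X. det u (g i))"
  by (induction X rule: infinite_finite_induct) (simp_all add: det_add_right)

lemma det_diff_right: "det u (v - w) = det u v - det u w"
  by (simp add: det_def algebra_simps)

lemma null_det_right: "null w \<Longrightarrow> int p dvd det u w"
  by (simp add: null_def det_def)

lemma parallel_sym: "parallel u v \<longleftrightarrow> parallel v u"
proof -
  have "det v u = - det u v" by (simp add: det_def algebra_simps)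
  then show ?thesis by (simp add: parallel_def)
qed

lemma parallel_refl [simp]: "parallel u u"
  by (simp add: parallel_def det_def algebra_simps)

lemma null_imp_parallel: "null u \<Longrightarrow> parallel u v"
  by (simp add: parallel_def det_def null_def)

text \<open>
  Parallelism is transitive only through a nonzero vector; the two identities in the proof are the
  coordinates of the Pluecker relation between three vectors of the plane.
\<close>

lemma parallel_trans:
  assumes "\<not> null v" "parallel u v" "parallel v w"
  shows "parallel u w"
proof -
  have "fst v * det u w = fst u * det v w + fst w * det u v"
    and "snd v * det u w = snd u * det v w + snd w * det u v"
    by (simp_all add: det_def algebra_simps)
  then have "int p dvd fst v * det u w" "int p dvd snd v * det u w"
    using assms(2,3) by (simp_all add: parallel_def)
  then show ?thesis
    using assms(1) by (auto simp: dvd_mult_iff null_def parallel_def)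
qed

lemma parallel_via_common:
  assumes "\<not> null v" "parallel v u" "parallel v w"
  shows "parallel u w"
proof (rule parallel_trans[OF assms(1) _ assms(3)])
  show "parallel u v" using assms(2) by (simp only: parallel_sym)
qed

lemma null_if_parallel_both:
  assumes "\<not> parallel u v" "parallel u w" "parallel v w"
  shows "null w"
proof -
  have "fst w * det u v = fst v * det u w - fst u * det v w"
    and "snd w * det u v = snd v * det u w - snd u * det v w"
    by (simp_all add: det_def algebra_simps)
  then have "int p dvd fst w * det u v" "int p dvd snd w * det u v"
    using assms(2,3) by (simp_all add: parallel_def)
  then show ?thesis
    using assms(1) by (auto simp: dvd_mult_iff null_def parallel_def)
qed

lemma add_not_null:
  assumes "\<not> parallel u v"
  shows "\<not> null (u + v)"
proof
  assume "null (u + v)"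
  then have "int p dvd det u (u + v)" by (rule null_det_right)
  moreover have "det u (u + v) = det u v" by (simp add: det_def algebra_simps)
  ultimately show False using assms by (simp add: parallel_def)
qed

lemma ex_not_parallel:
  assumes "\<not> null x"
  obtains y where "\<not> int p dvd det y x"
proof (cases "int p dvd fst x")
  case True
  then show thesis using that[of "(1, 0)"] assms by (simp add: det_def null_def)
next
  case False
  then show thesis using that[of "(0, 1)"] by (simp add: det_def)
qed

definition smul :: "int \<Rightarrow> int \<times> int \<Rightarrow> int \<times> int" where
  "smul k v = (k * fst v, k * snd v)"

lemma smul_Suc: "v - smul (int (Suc n)) w = (v - smul (int n) w) - w"
  by (simp add: smul_def prod_eq_iff algebra_simps)

lemma det_smul_right: "det u (smul k v) = k * det u v"
  by (simp add: det_def smul_def algebra_simps)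

lemma solve_linear_mod:
  assumes "\<not> int p dvd d"
  obtains n :: nat where "[int n * d = t] (mod int p)"
proof -
  have "coprime d (int p)"
    using assms prime_int_p prime_imp_coprime coprime_commute by blast
  then obtain x where x: "[d * x = 1] (mod int p)"
    using cong_solve_coprime_int by blast
  have "[int (nat (x * t mod int p)) * d = (x * t) * d] (mod int p)"
    using p_gt_1 by (intro cong_scalar_right) (simp add: cong_def)
  moreover have "[(d * x) * t = 1 * t] (mod int p)"
    using x by (rule cong_scalar_right)
  ultimately have "[int (nat (x * t mod int p)) * d = t] (mod int p)"
    by (metis (no_types, opaque_lifting) cong_trans mult.assoc mult.commute mult_1)
  then show thesis by (rule that)
qed

lemma parallel_multiple:
  assumes "\<not> null x" "parallel x y"
  obtains n :: nat where "null (y - smul (int n) x)"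
proof (cases "int p dvd fst x")
  case True
  then have *: "\<not> int p dvd snd x" using assms(1) by (simp add: null_def)
  then obtain n :: nat where n: "[int n * snd x = snd y] (mod int p)"
    by (rule solve_linear_mod)
  have "int p dvd snd x * fst y"
    using assms(2) True unfolding parallel_def det_def
    by (metis dvd_diff_right_iff dvd_mult2)
  then have "int p dvd fst y" using * by (simp add: dvd_mult_iff)
  then have "null (y - smul (int n) x)"
    using True n by (simp add: null_def smul_def cong_iff_dvd_diff dvd_diff_commute)
  then show thesis by (rule that)
next
  case False
  then obtain n :: nat where n: "[int n * fst x = fst y] (mod int p)"
    by (rule solve_linear_mod)
  have "fst x * (snd y - int n * snd x) = det x y - snd x * (int n * fst x - fst y)"
    by (simp add: det_def algebra_simps)
  then have "int p dvd fst x * (snd y - int n * snd x)"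
    using assms(2) n by (simp add: parallel_def cong_iff_dvd_diff)
  then have "int p dvd snd y - int n * snd x"
    using False by (simp add: dvd_mult_iff)
  then have "null (y - smul (int n) x)"
    using n by (simp add: null_def smul_def cong_iff_dvd_diff dvd_diff_commute)
  then show thesis by (rule that)
qed

section \<open>Signed subset counts and their periods\<close>

definition period :: "(int \<times> int \<Rightarrow> int) \<Rightarrow> int \<times> int \<Rightarrow> bool" where
  "period f w \<longleftrightarrow> (\<forall>v. [f (v - w) = f v] (mod int p))"

lemma periodD: "period f w \<Longrightarrow> [f (v - w) = f v] (mod int p)"
  by (simp only: period_def)

lemma period_smul:
  assumes "period f w"
  shows "period f (smul (int n) w)"
proof (induction n)
  case 0
  then show ?case by (simp add: period_def smul_def zero_prod_def[symmetric])
next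
  case (Suc n)
  have "v - smul (int (Suc n)) w = (v - smul (int n) w) - w" for v
    by (simp add: smul_def prod_eq_iff algebra_simps)
  then show ?case
    using Suc assms unfolding period_def by (metis cong_trans)
qed

lemma period_all:
  assumes per: "period f x" "period f y" and ind: "\<not> parallel x y"
    and null: "\<And>w. null w \<Longrightarrow> period f w"
  shows "[f u = f v] (mod int p)"
proof -
  have D: "\<not> int p dvd det x y" using ind by (simp add: parallel_def)
  obtain m :: nat where m: "[int m * det x y = det (v - u) y] (mod int p)"
    using solve_linear_mod[OF D] by blast
  obtain n :: nat where n: "[int n * det x y = det x (v - u)] (mod int p)"
    using solve_linear_mod[OF D] by blast
  define w where "w = v - u - smul (int m) x - smul (int n) y"
  have "det w y = - (int m * det x y - det (v - u) y)"
    "det x w = - (int n * det x y - det x (v - u))"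
    by (simp_all add: w_def det_def smul_def algebra_simps)
  then have "parallel w y" "parallel x w"
    using m n unfolding parallel_def cong_iff_dvd_diff dvd_minus_iff
    by (simp_all only: dvd_minus_iff)
  then have "null w"
    using null_if_parallel_both[OF ind] parallel_sym by blast
  then have "period f w" by (rule null)
  then have "[f (v - smul (int m) x - smul (int n) y - w) = f v] (mod int p)"
    using period_smul[OF per(1), of m] period_smul[OF per(2), of n]
    unfolding period_def by (meson cong_trans)
  then show ?thesis by (simp add: w_def)
qed

text \<open>
  The coefficient of \<open>X\<^sup>v\<close> in the product of \<open>1 - X\<^bsup>g i\<^esup>\<close> over \<open>i \<in> R\<close>, taken in the integral
  group ring of the plane modulo \<open>p\<close>.
\<close>

definition signed_count :: "('i \<Rightarrow> int \<times> int) \<Rightarrow> 'i set \<Rightarrow> int \<times> int \<Rightarrow> int" where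
  "signed_count g R v = (\<Sum>X | X \<subseteq> R \<and> null (sum g X - v). (-1) ^ card X)"

lemma period_null: "null w \<Longrightarrow> period (signed_count g R) w"
  unfolding period_def signed_count_def by (simp add: null_shift)

lemma signed_count_alt:
  assumes "finite R"
  shows "signed_count g R v = (\<Sum>X\<in>Pow R. if null (sum g X - v) then (-1) ^ card X else 0)"
proof -
  have "{X. X \<subseteq> R \<and> null (sum g X - v)} = {X \<in> Pow R. null (sum g X - v)}" by auto
  then show ?thesis
    unfolding signed_count_def using assms by (simp only: sum.inter_filter finite_Pow_iff)
qed

text \<open>
  Multiplication by the factor \<open>1 - X\<^bsup>g r\<^esup>\<close>.
\<close>

lemma signed_count_insert:
  assumes "finite R" "r \<notin> R"
  shows "signed_count g (insert r R) v = signed_count g R v - signed_count g R (v - g r)"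
proof -
  have *: "(\<Sum>X\<in>Pow R. if null (sum g (insert r X) - v) then (-1) ^ card (insert r X) else 0)
    = (\<Sum>X\<in>Pow R. - (if null (sum g X - (v - g r)) then (-1) ^ card X else (0::int)))"
  proof (rule sum.cong)
    fix X assume "X \<in> Pow R"
    then have "r \<notin> X" "finite X" using assms finite_subset by auto
    then show "(if null (sum g (insert r X) - v) then (-1) ^ card (insert r X) else 0)
      = - (if null (sum g X - (v - g r)) then (-1) ^ card X else (0::int))"
      by (simp add: algebra_simps)
  qed simp
  show ?thesis
    using assms by (simp add: signed_count_alt sum_Pow_insert * sum_negf)
qed

lemma signed_sum_monomial_zero:
  fixes g :: "'i \<Rightarrow> int \<times> int"
  assumes "finite R" "m + n < card R"
  shows "(\<Sum>X\<in>Pow R. (-1) ^ card X * (fst (sum g X - v) ^ m * snd (sum g X - v) ^ n)) = 0"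
proof -
  define c where "c t = (if t < m then - fst v else - snd v)" for t
  define w where "w t i = (if t < m then fst (g i) else snd (g i))" for t i
  have "(\<Prod>t<m + n. c t + (\<Sum>i\<in>X. w t i)) = fst (sum g X - v) ^ m * snd (sum g X - v) ^ n"
    (is "?l = _") for X
  proof -
    have "{..<m + n} = {..<m} \<union> {m..<m + n}" by auto
    then have "?l = (\<Prod>t<m. c t + (\<Sum>i\<in>X. w t i)) * (\<Prod>t=m..<m + n. c t + (\<Sum>i\<in>X. w t i))"
      by (simp add: prod.union_disjoint ivl_disj_int)
    also have "(\<Prod>t<m. c t + (\<Sum>i\<in>X. w t i)) = (\<Prod>t<m. fst (sum g X - v))"
      by (rule prod.cong) (simp_all add: c_def w_def fst_sum)
    also have "(\<Prod>t=m..<m + n. c t + (\<Sum>i\<in>X. w t i)) = (\<Prod>t=m..<m + n. snd (sum g X - v))"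
      by (rule prod.cong) (simp_all add: c_def w_def snd_sum)
    finally show ?thesis by simp
  qed
  then show ?thesis
    using signed_sum_prod_linear_zero[of "{..<m + n}" R "{}" c w] assms
    by (simp add: Pow_def)
qed

text \<open>
  By Fermat's little theorem the indicator of the zero vector is a polynomial of degree \<open>2 p - 2\<close> in
  the coordinates.
\<close>

lemma indicator_null_cong:
  "[(if null w then 1 else 0) = (1 - fst w ^ (p - 1)) * (1 - snd w ^ (p - 1))] (mod int p)"
proof -
  have one: "[x ^ (p - 1) = 1] (mod int p)" if "\<not> int p dvd x" for x
  proof -
    have "int (nat (x mod int p)) = x mod int p" using p_gt_1 by simp
    moreover from this have "\<not> p dvd nat (x mod int p)"
      using that by (metis dvd_mod_iff int_dvd_int_iff dvd_refl)
    then have "[nat (x mod int p) ^ (p - 1) = 1] (mod p)"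
      using fermat_theorem prime_p by blast
    then have "[int (nat (x mod int p)) ^ (p - 1) = 1] (mod int p)"
      by (metis cong_int_iff of_nat_1 of_nat_power)
    ultimately show ?thesis by (simp add: cong_def power_mod)
  qed
  have zero: "[x ^ (p - 1) = 0] (mod int p)" if "int p dvd x" for x
    using that p_gt_1 by (simp add: cong_0_iff dvd_power_le dvd_trans[OF _ dvd_power])
  show ?thesis
  proof (cases "null w")
    case True
    then have "[(1 - fst w ^ (p - 1)) * (1 - snd w ^ (p - 1)) = (1 - 0) * (1 - 0)] (mod int p)"
      by (intro cong_mult cong_diff cong_refl zero) (simp_all add: null_def)
    then show ?thesis using True by (simp add: cong_sym)
  next
    case False
    then consider "\<not> int p dvd fst w" | "\<not> int p dvd snd w" by (auto simp: null_def)
    then show ?thesis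
    proof cases
      case 1
      then have "int p dvd 1 - fst w ^ (p - 1)"
        using one by (simp add: cong_iff_dvd_diff dvd_diff_commute)
      then show ?thesis using False by (simp add: cong_iff_dvd_diff)
    next
      case 2
      then have "int p dvd 1 - snd w ^ (p - 1)"
        using one by (simp add: cong_iff_dvd_diff dvd_diff_commute)
      then show ?thesis using False by (simp add: cong_iff_dvd_diff)
    qed
  qed
qed

text \<open>
  The augmentation ideal of the group ring of the plane over the field with \<open>p\<close> elements has
  nilpotency index \<open>2 p - 1\<close>: the
  indicator of the zero vector has degree \<open>2 p - 2\<close>, so each of its monomials is annihilated by the
  alternating sum over the subsets of a larger set.
\<close>

lemma signed_count_vanishes:
  assumes "finite R" "card R \<ge> 2 * p - 1"
  shows "int p dvd signed_count g R v"
proof -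
  define x where "x X = fst (sum g X - v)" for X
  define y where "y X = snd (sum g X - v)" for X
  have "[signed_count g R v
      = (\<Sum>X\<in>Pow R. (-1) ^ card X * ((1 - x X ^ (p - 1)) * (1 - y X ^ (p - 1))))] (mod int p)"
    unfolding signed_count_alt[OF assms(1)]
  proof (rule cong_sum)
    fix X
    have "[(-1) ^ card X * (if null (sum g X - v) then 1 else 0) =
      (-1) ^ card X * ((1 - x X ^ (p - 1)) * (1 - y X ^ (p - 1)))] (mod int p)"
      unfolding x_def y_def by (intro cong_scalar_left indicator_null_cong)
    then show "[(if null (sum g X - v) then (-1) ^ card X else 0) =
      (-1) ^ card X * ((1 - x X ^ (p - 1)) * (1 - y X ^ (p - 1)))] (mod int p)"
      by (simp split: if_splits)
  qed
  also have "(\<Sum>X\<in>Pow R. (-1) ^ card X * ((1 - x X ^ (p - 1)) * (1 - y X ^ (p - 1))))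
    = (\<Sum>X\<in>Pow R. (-1) ^ card X * (x X ^ 0 * y X ^ 0))
      - (\<Sum>X\<in>Pow R. (-1) ^ card X * (x X ^ (p - 1) * y X ^ 0))
      - (\<Sum>X\<in>Pow R. (-1) ^ card X * (x X ^ 0 * y X ^ (p - 1)))
      + (\<Sum>X\<in>Pow R. (-1) ^ card X * (x X ^ (p - 1) * y X ^ (p - 1)))"
    unfolding sum.distrib[symmetric] sum_subtractf[symmetric]
    by (rule sum.cong) (simp_all add: algebra_simps)
  also have "\<dots> = 0"
    unfolding x_def y_def using assms p_gt_1 by (subst signed_sum_monomial_zero, simp, simp)+ simp
  finally show ?thesis by (simp add: cong_0_iff)
qed

text \<open>
  Olson's theorem for the plane.  If only the empty set had sum zero, the signed count at the
  origin would be \<open>1\<close> and not divisible by \<open>p\<close>.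
\<close>

lemma zero_sum_subset:
  assumes "finite R" "card R \<ge> 2 * p - 1"
  obtains X where "X \<subseteq> R" "X \<noteq> {}" "null (sum g X)"
proof (rule ccontr)
  assume "\<not> thesis"
  then have "{X. X \<subseteq> R \<and> null (sum g X - 0)} = {{}}"
    using that by (auto simp: null_def)
  then have "signed_count g R 0 = 1" by (simp add: signed_count_def)
  then show False using signed_count_vanishes[OF assms, of g 0] p_gt_1 by simp
qed

section \<open>Exchanging a vector along a period\<close>

text \<open>
  Multiplying the coefficient function pointwise by a linear functional, here \<open>det y\<close>, is a
  derivation of the group ring.  Its value on \<open>1 - X\<^bsup>g i\<^esup>\<close> is \<open>- det y (g i) X\<^bsup>g i\<^esup>\<close>, and the
  statement is the Leibniz rule for the product over \<open>R\<close>.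
\<close>

lemma signed_count_moment:
  assumes "finite R"
  shows "[det y v * signed_count g R v
      = - (\<Sum>i\<in>R. det y (g i) * signed_count g (R - {i}) (v - g i))] (mod int p)"
  using assms
proof (induction R arbitrary: v rule: finite_induct)
  case empty
  have "int p dvd det y v" if "null (- v)"
    using that null_minus null_det_right by blast
  moreover have "signed_count g {} v = (if null (- v) then 1 else 0)"
    by (simp add: signed_count_alt)
  ultimately show ?case by (simp add: cong_0_iff)
next
  case (insert r R)
  let ?F = "signed_count g"
  let ?S = "\<lambda>v. \<Sum>i\<in>R. det y (g i) * ?F (R - {i}) (v - g i)"
  have "det y v * ?F (insert r R) v
      = det y v * ?F R v - det y (v - g r) * ?F R (v - g r) - det y (g r) * ?F R (v - g r)"
    using insert by (simp add: signed_count_insert det_diff_right algebra_simps)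
  moreover have "[\<dots> = - ?S v - (- ?S (v - g r)) - det y (g r) * ?F R (v - g r)] (mod int p)"
    by (intro cong_diff insert.IH cong_refl)
  moreover have "- ?S v - (- ?S (v - g r))
      = - (\<Sum>i\<in>R. det y (g i) * ?F (insert r R - {i}) (v - g i))"
  proof -
    have "?F (insert r R - {i}) (v - g i) = ?F (R - {i}) (v - g i) - ?F (R - {i}) (v - g r - g i)"
      if "i \<in> R" for i
    proof -
      have "insert r R - {i} = insert r (R - {i})" using insert that by auto
      then show ?thesis using insert by (simp add: signed_count_insert algebra_simps)
    qed
    then have "(\<Sum>i\<in>R. det y (g i) * ?F (insert r R - {i}) (v - g i)) = ?S v - ?S (v - g r)"
      by (simp add: sum_subtractf right_diff_distrib)
    then show ?thesis by simp
  qed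
  moreover have "- (\<Sum>i\<in>insert r R. det y (g i) * ?F (insert r R - {i}) (v - g i))
      = - (\<Sum>i\<in>R. det y (g i) * ?F (insert r R - {i}) (v - g i)) - det y (g r) * ?F R (v - g r)"
  proof -
    have "insert r R - {r} = R" using insert by auto
    then show ?thesis using insert.hyps by simp
  qed
  ultimately show ?case by simp
qed

lemma signed_count_remove:
  assumes "finite R" "i \<in> R"
  shows "signed_count g R v = signed_count g (R - {i}) v - signed_count g (R - {i}) (v - g i)"
  using signed_count_insert[of "R - {i}" i g v] assms by (simp add: insert_absorb)

text \<open>
  Here \<open>g i\<close> is \<open>n\<close> times \<open>x\<close>, so the coefficient function of \<open>R\<close> is the difference of \<open>h\<close> along
  \<open>n x\<close>.  Since it has period \<open>x\<close>, the difference \<open>D\<close> of \<open>h\<close> along \<open>x\<close> has period \<open>n x\<close>, hence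
  period \<open>x\<close> because \<open>n\<close> is invertible modulo \<open>p\<close>, and telescoping \<open>n\<close> steps along \<open>x\<close> yields
  \<open>n D\<close>.
\<close>

lemma derivative_along_period:
  assumes R: "finite R" "i \<in> R" and f: "period (signed_count g R) x"
    and n: "null (g i - smul (int n) x)" and gi: "\<not> null (g i)"
  defines "h \<equiv> signed_count g (R - {i})"
  shows "[int n * (h v - h (v - x)) = signed_count g R v] (mod int p)"
proof -
  define D where "D v = h v - h (v - x)" for v
  have per0: "period D w" if "null w" for w
  proof -
    have "h (v - w) = h v" for v unfolding h_def signed_count_def by (simp add: null_shift that)
    moreover have "v - w - x = v - x - w" for v by simp
    ultimately show ?thesis unfolding period_def D_def by (simp only: cong_refl simp_thms)
  qed
  have hi: "h (v - g i) = h (v - smul (int n) x)" for v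
  proof -
    have "v - g i = v - smul (int n) x - (g i - smul (int n) x)" by simp
    then show ?thesis unfolding h_def signed_count_def by (metis (no_types, lifting) n null_shift)
  qed
  have f_eq: "signed_count g R v = h v - h (v - smul (int n) x)" for v
    using signed_count_remove[OF R] hi by (simp add: h_def)
  have "\<not> int p dvd int n"
  proof
    assume "int p dvd int n"
    then have "null (smul (int n) x)" by (simp add: null_def smul_def)
    from null_add[OF n this] show False using gi by simp
  qed
  then obtain m where m: "[int m * int n = 1] (mod int p)" by (rule solve_linear_mod)
  have "period D (smul (int n) x)"
    unfolding period_def
  proof
    fix v
    have "[signed_count g R v = signed_count g R (v - x)] (mod int p)"
      using periodD[OF f] by (rule cong_sym)
    then show "[D (v - smul (int n) x) = D v] (mod int p)"
      unfolding f_eq D_def cong_iff_dvd_diff by (subst dvd_diff_commute) (simp add: algebra_simps)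
  qed
  then have per1: "period D (smul (int m) (smul (int n) x))" by (rule period_smul)
  have per: "period D x"
    unfolding period_def
  proof
    fix v
    define w where "w = smul (int m) (smul (int n) x) - x"
    have "fst w = (int m * int n - 1) * fst x" "snd w = (int m * int n - 1) * snd x"
      by (simp_all add: w_def smul_def algebra_simps)
    then have "null w" using m by (simp add: null_def cong_iff_dvd_diff)
    then have "[D (v - x - w) = D (v - x)] (mod int p)" by (rule periodD[OF per0])
    moreover have "v - x - w = v - smul (int m) (smul (int n) x)" by (simp add: w_def)
    ultimately show "[D (v - x) = D v] (mod int p)"
      using periodD[OF per1, of v] by (metis cong_sym cong_trans)
  qed
  have "[h v - h (v - smul (int k) x) = int k * D v] (mod int p)" for k
  proof (induction k)
    case 0
    then show ?case by (simp add: smul_def zero_prod_def[symmetric])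
  next
    case (Suc k)
    have "h v - h (v - smul (int (Suc k)) x)
        = (h v - h (v - smul (int k) x)) + D (v - smul (int k) x)"
      by (simp only: smul_Suc D_def)
    also have "[\<dots> = int k * D v + D v] (mod int p)"
      by (rule cong_add[OF Suc periodD[OF period_smul[OF per]]])
    finally show ?case by (simp add: algebra_simps)
  qed
  then show ?thesis unfolding f_eq D_def by (rule cong_sym)
qed

text \<open>
  Suppose, for contradiction, that the coefficient functions of all \<open>R - {i}\<close> with \<open>g i\<close> off the
  line of \<open>x\<close> also have period \<open>x\<close>.  Choose a linear
  functional \<open>\<lambda>\<close> with \<open>\<lambda> x \<noteq> 0\<close>, multiply the coefficient function \<open>f\<close> of \<open>R\<close> by it, and take the
  difference along \<open>x\<close>.  As \<open>f\<close> has period \<open>x\<close>, the result is \<open>\<lambda> x\<close> times \<open>f\<close>.  In the Leibniz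
  expansion the terms off the line disappear, and each of the \<open>e\<close> terms on the line contributes
  \<open>- \<lambda> x\<close> times \<open>f\<close>.  So \<open>(e + 1) (\<lambda> x) f\<close> vanishes, although \<open>0 < e + 1 < p\<close> and \<open>f\<close> does not vanish.
  The conclusion says that replacing \<open>i\<close> by a new index with vector \<open>x\<close> keeps the product nonzero.
\<close>

lemma exchange:
  assumes R: "finite R" and g: "\<And>i. i \<in> R \<Longrightarrow> \<not> null (g i)" and x: "\<not> null x"
    and per: "period (signed_count g R) x"
    and small: "card {i \<in> R. parallel x (g i)} + 1 < p"
    and nz: "\<not> int p dvd signed_count g R v"
  obtains i w where "i \<in> R" "\<not> parallel x (g i)"
    "\<not> [signed_count g (R - {i}) (w - x) = signed_count g (R - {i}) w] (mod int p)"
proof (rule ccontr)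
  assume "\<not> thesis"
  note neg = this and witness = that
  have off: "period (signed_count g (R - {i})) x" if i: "i \<in> R" "\<not> parallel x (g i)" for i
    using neg witness i unfolding period_def by blast
  let ?F = "signed_count g"
  obtain y where y: "\<not> int p dvd det y x" using ex_not_parallel[OF x] .
  define E where "E = {i \<in> R. parallel x (g i)}"
  define t where "t i = det y (g i) * (?F (R - {i}) (v - g i) - ?F (R - {i}) (v - g i - x))" for i
  have t_off: "[t i = 0] (mod int p)" if "i \<in> R" "i \<notin> E" for i
  proof -
    have "[?F (R - {i}) (v - g i - x) = ?F (R - {i}) (v - g i)] (mod int p)"
      using that by (intro periodD[OF off]) (simp_all add: E_def)
    then show ?thesis
      by (simp add: t_def cong_0_iff cong_iff_dvd_diff dvd_diff_commute)
  qed
  have t_on: "[t i = det y x * ?F R v] (mod int p)" if "i \<in> E" for i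
  proof -
    have i: "i \<in> R" "parallel x (g i)" using that by (auto simp: E_def)
    obtain n :: nat where n: "null (g i - smul (int n) x)" using parallel_multiple[OF x i(2)] .
    have "int p dvd det y (g i - smul (int n) x)" using n by (rule null_det_right)
    then have "[det y (g i) = int n * det y x] (mod int p)"
      by (simp add: det_diff_right det_smul_right cong_iff_dvd_diff)
    then have "[t i = (int n * det y x) * (?F (R - {i}) (v - g i) - ?F (R - {i}) (v - g i - x))] (mod int p)"
      unfolding t_def by (rule cong_scalar_right)
    also have "(int n * det y x) * (?F (R - {i}) (v - g i) - ?F (R - {i}) (v - g i - x))
        = det y x * (int n * (?F (R - {i}) (v - g i) - ?F (R - {i}) (v - g i - x)))"
      by simp
    also have "[det y x * (int n * (?F (R - {i}) (v - g i) - ?F (R - {i}) (v - g i - x)))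
        = det y x * ?F R (v - g i)] (mod int p)"
      using derivative_along_period[OF R i(1) per n g[OF i(1)]] by (rule cong_scalar_left)
    also have "[det y x * ?F R (v - g i) = det y x * ?F R v] (mod int p)"
    proof (rule cong_scalar_left)
      have "v - g i = v - smul (int n) x - (g i - smul (int n) x)" by simp
      then have "[?F R (v - g i) = ?F R (v - smul (int n) x)] (mod int p)"
        using periodD[OF period_null[OF n], of g R "v - smul (int n) x"] by simp
      then show "[?F R (v - g i) = ?F R v] (mod int p)"
        using periodD[OF period_smul[OF per]] by (rule cong_trans)
    qed
    finally show ?thesis .
  qed
  have "[det y x * ?F R v = det y v * ?F R v - det y (v - x) * ?F R (v - x)] (mod int p)"
  proof -
    have "[det y (v - x) * ?F R (v - x) = det y (v - x) * ?F R v] (mod int p)"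
      using periodD[OF per] by (rule cong_scalar_left)
    then have "[det y v * ?F R v - det y (v - x) * ?F R (v - x)
        = det y v * ?F R v - det y (v - x) * ?F R v] (mod int p)"
      by (intro cong_diff cong_refl)
    moreover have "det y v * ?F R v - det y (v - x) * ?F R v = det y x * ?F R v"
      by (simp add: det_diff_right algebra_simps)
    ultimately show ?thesis by (simp only: cong_sym_eq)
  qed
  also have "[det y v * ?F R v - det y (v - x) * ?F R (v - x)
      = - (\<Sum>i\<in>R. det y (g i) * ?F (R - {i}) (v - g i))
        - (- (\<Sum>i\<in>R. det y (g i) * ?F (R - {i}) (v - x - g i)))] (mod int p)"
    by (intro cong_diff signed_count_moment R)
  also have "- (\<Sum>i\<in>R. det y (g i) * ?F (R - {i}) (v - g i))
        - (- (\<Sum>i\<in>R. det y (g i) * ?F (R - {i}) (v - x - g i))) = - (\<Sum>i\<in>R. t i)"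
    by (simp add: t_def sum_subtractf right_diff_distrib algebra_simps)
  also have "[- (\<Sum>i\<in>R. t i) = - (\<Sum>i\<in>R. if i \<in> E then det y x * ?F R v else 0)] (mod int p)"
    using t_off t_on by (subst cong_minus_minus_iff) (intro cong_sum, simp)
  also have "(\<Sum>i\<in>R. if i \<in> E then det y x * ?F R v else 0) = int (card E) * (det y x * ?F R v)"
  proof -
    have "R \<inter> E = E" by (auto simp: E_def)
    then show ?thesis using R by (simp add: sum.If_cases)
  qed
  finally have "int p dvd det y x * ?F R v + int (card E) * (det y x * ?F R v)"
    by (simp add: cong_iff_dvd_diff)
  then have "int p dvd int (card E + 1) * (det y x * ?F R v)"
    by (simp add: algebra_simps)
  moreover have "\<not> int p dvd int (card E + 1)"
    using small by (intro not_dvd_of_nat) (simp_all add: E_def)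
  ultimately show False using y nz by (simp add: dvd_mult_iff del: of_nat_add)
qed

section \<open>Sets whose subset sums cover the plane\<close>

definition covers :: "('i \<Rightarrow> int \<times> int) \<Rightarrow> 'i set \<Rightarrow> bool" where
  "covers g R \<longleftrightarrow> (\<forall>v. \<exists>X \<subseteq> R. null (sum g X - v))"

lemma covers_mono: "covers g R \<Longrightarrow> R \<subseteq> R' \<Longrightarrow> covers g R'"
  unfolding covers_def by (meson subset_trans)

lemma constant_count_covers:
  assumes "\<And>u. [signed_count g R u = signed_count g R v] (mod int p)"
    and "\<not> int p dvd signed_count g R v"
  shows "covers g R"
  unfolding covers_def
proof
  fix u
  have "\<not> int p dvd signed_count g R u" using assms cong_dvd_iff by blast
  then have "{X. X \<subseteq> R \<and> null (sum g X - u)} \<noteq> {}"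
    unfolding signed_count_def by (metis dvd_0_right sum.empty)
  then show "\<exists>X\<subseteq>R. null (sum g X - u)" by blast
qed

text \<open>
  A further factor \<open>1 - X\<^sup>w\<close> makes the product vanish; the proof carries \<open>w\<close> on a fresh index, for
  which the index type has to be infinite.
\<close>

lemma period_all_if_large:
  fixes g :: "nat \<Rightarrow> int \<times> int"
  assumes "finite R" "card R \<ge> 2 * p - 2"
  shows "period (signed_count g R) w"
  unfolding period_def
proof
  fix v
  obtain z where z: "z \<notin> R" using assms(1) ex_new_if_finite infinite_UNIV_nat by blast
  let ?g = "g(z := w)"
  have eq: "signed_count ?g R = signed_count g R"
  proof -
    have "sum ?g X = sum g X" if "X \<subseteq> R" for X
      using that z by (intro sum.cong) auto
    then have "{X. X \<subseteq> R \<and> null (sum ?g X - v)} = {X. X \<subseteq> R \<and> null (sum g X - v)}" for v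
      by auto
    then show ?thesis by (simp add: signed_count_def fun_eq_iff)
  qed
  have "int p dvd signed_count ?g (insert z R) v"
    using assms z by (intro signed_count_vanishes) simp_all
  then show "[signed_count g R (v - w) = signed_count g R v] (mod int p)"
    using assms z by (simp add: signed_count_insert eq cong_iff_dvd_diff dvd_diff_commute)
qed

text \<open>
  Among the subsets of \<open>R\<close> with nonvanishing signed count let \<open>Q\<close> be one of maximal size.
  By maximality every vector left over is a period, so \<open>Q\<close> covers the plane if two vectors left
  over are independent; it also does so if it has \<open>2 p - 2\<close> elements.  The index \<open>r\<close> is then sought
  among those left over.  In the remaining situations all vectors left over lie on one line, and
  the bound on the lines allows to exchange one of them for an index \<open>i\<close> of \<open>Q\<close> off that line; the
  new set is again of maximal size, and now the vectors left over are no longer confined to the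
  line.
\<close>

lemma ex_covering_complement:
  fixes g :: "nat \<Rightarrow> int \<times> int"
  assumes R: "finite R" "card R = 2 * p - 1"
    and g: "\<And>i. i \<in> R \<Longrightarrow> \<not> null (g i)"
    and lines: "\<And>i. i \<in> R \<Longrightarrow> card {j \<in> R. parallel (g i) (g j)} < p"
    and \<tau>: "\<not> null \<tau>"
  obtains r where "r \<in> R" "\<not> parallel \<tau> (g r)" "covers g (R - {r})"
proof -
  define nz where "nz Q \<longleftrightarrow> Q \<subseteq> R \<and> (\<exists>v. \<not> int p dvd signed_count g Q v)" for Q
  have "signed_count g {} 0 = 1" by (simp add: signed_count_alt null_def)
  then have "\<not> int p dvd signed_count g {} 0" using p_gt_1 by simp
  then have "nz {}" unfolding nz_def by blast
  moreover have "\<forall>Q. nz Q \<longrightarrow> card Q < Suc (card R)"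
    using card_mono[OF R(1)] by (auto simp: nz_def less_Suc_eq_le)
  ultimately obtain Q where Q: "nz Q" and max: "\<And>Q'. nz Q' \<Longrightarrow> card Q' \<le> card Q"
    using ex_has_greatest_nat[of nz "{}" card "Suc (card R)"] by blast
  have fin: "finite Q'" if "Q' \<subseteq> R" for Q' using that R(1) finite_subset by blast
  have QR: "Q \<subseteq> R" using Q by (simp add: nz_def)
  have small: "card Q \<le> 2 * p - 2"
  proof -
    have "\<not> card Q \<ge> 2 * p - 1"
      using Q signed_count_vanishes[OF fin[OF QR]] by (auto simp: nz_def)
    then show ?thesis by simp
  qed
  have leftover_period: "period (signed_count g Q') (g r)"
    if Q': "nz Q'" "card Q' = card Q" and r: "r \<in> R - Q'" for Q' r
    unfolding period_def
  proof
    fix v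
    have f: "finite Q'" using Q' by (simp add: nz_def fin)
    have "card (insert r Q') = Suc (card Q)" using Q' r f by simp
    then have "\<not> nz (insert r Q')" using max[of "insert r Q'"] by auto
    moreover have "insert r Q' \<subseteq> R" using Q'(1) r by (simp add: nz_def)
    ultimately have "\<not> (\<exists>v. \<not> int p dvd signed_count g (insert r Q') v)"
      unfolding nz_def by (simp only: simp_thms)
    then have "int p dvd signed_count g (insert r Q') v" by blast
    then show "[signed_count g Q' (v - g r) = signed_count g Q' v] (mod int p)"
      using f r by (simp add: signed_count_insert cong_iff_dvd_diff dvd_diff_commute)
  qed
  have cov: "covers g Q'"
    if Q': "nz Q'" "card Q' = card Q"
      and ind: "card Q = 2 * p - 2 \<or> (\<exists>r\<in>R - Q'. \<exists>r'\<in>R - Q'. \<not> parallel (g r) (g r'))" for Q'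
  proof -
    obtain v where v: "\<not> int p dvd signed_count g Q' v" using Q' by (auto simp: nz_def)
    have f: "finite Q'" using Q' by (simp add: nz_def fin)
    have "[signed_count g Q' u = signed_count g Q' v] (mod int p)" for u
      using ind
    proof
      assume "card Q = 2 * p - 2"
      then have "period (signed_count g Q') (v - u)"
        using f Q' by (intro period_all_if_large) simp_all
      then show ?thesis using periodD[of "signed_count g Q'" "v - u" v] by simp
    next
      assume "\<exists>r\<in>R - Q'. \<exists>r'\<in>R - Q'. \<not> parallel (g r) (g r')"
      then show ?thesis
        using leftover_period[OF Q'] period_all[OF _ _ _ period_null] by metis
    qed
    then show ?thesis using constant_count_covers v by blast
  qed
  have finish: thesis if Q': "nz Q'" "covers g Q'" "r \<in> R - Q'" "\<not> parallel \<tau> (g r)" for Q' r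
  proof (rule \<open>\<And>r. r \<in> R \<Longrightarrow> \<not> parallel \<tau> (g r) \<Longrightarrow> covers g (R - {r}) \<Longrightarrow> thesis\<close>)
    show "covers g (R - {r})" using Q' by (intro covers_mono[OF Q'(2)]) (auto simp: nz_def)
  qed (use Q' in auto)
  have cardRem: "card (R - Q) = 2 * p - 1 - card Q"
    using QR R fin by (simp add: card_Diff_subset)
  then have "card (R - Q) > 0" using small p_gt_1 by linarith
  then have "R - Q \<noteq> {}" by (metis card.empty less_irrefl)
  then obtain x where x: "x \<in> R" "x \<notin> Q" by blast
  show thesis
  proof (cases "\<exists>r\<in>R - Q. \<not> parallel \<tau> (g r)
      \<and> (card Q = 2 * p - 2 \<or> (\<exists>r'\<in>R - Q. \<not> parallel (g r) (g r')))")
    case True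
    then show thesis using finish cov[of Q] Q by blast
  next
    case False
    have line: "parallel (g x) (g r)" if r: "r \<in> R - Q" for r
    proof (cases "\<exists>r0\<in>R - Q. \<not> parallel \<tau> (g r0)")
      case True
      then obtain r0 where r0: "r0 \<in> R - Q" "\<not> parallel \<tau> (g r0)" by blast
      then have "parallel (g r0) (g x)" "parallel (g r0) (g r)" using False x r by blast+
      then show ?thesis using parallel_via_common[of "g r0"] g r0(1) by blast
    next
      case False
      then have "parallel \<tau> (g x)" "parallel \<tau> (g r)" using x r by blast+
      then show ?thesis by (rule parallel_via_common[OF \<tau>])
    qed
    obtain v where v: "\<not> int p dvd signed_count g Q v" using Q by (auto simp: nz_def)
    \<comment> \<open>The index \<open>x\<close> left over lies on its own line, so strictly fewer than \<open>p - 1\<close> are left in \<open>Q\<close>.\<close>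
    have "card {i \<in> Q. parallel (g x) (g i)} + 1 = card (insert x {i \<in> Q. parallel (g x) (g i)})"
      using x fin[OF QR] by simp
    also have "\<dots> \<le> card {j \<in> R. parallel (g x) (g j)}"
      using x QR R(1) by (intro card_mono) auto
    also have "\<dots> < p" by (rule lines[OF x(1)])
    finally have few: "card {i \<in> Q. parallel (g x) (g i)} + 1 < p" .
    have "period (signed_count g Q) (g x)" using leftover_period[OF Q] x by blast
    then obtain i w where i: "i \<in> Q" "\<not> parallel (g x) (g i)" and
      w: "\<not> [signed_count g (Q - {i}) (w - g x) = signed_count g (Q - {i}) w] (mod int p)"
      using exchange[OF fin[OF QR] _ g[OF x(1)] _ few v] g QR by (metis subsetD)
    define Q' where "Q' = insert x (Q - {i})"
    have cQ': "card Q' = card Q"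
      unfolding Q'_def using i x fin[OF QR] card_Suc_Diff1[of Q i] by simp
    have "\<not> int p dvd signed_count g Q' w"
      using w x fin[OF QR] by (simp add: Q'_def signed_count_insert cong_iff_dvd_diff dvd_diff_commute)
    moreover have "Q' \<subseteq> R" using QR x by (auto simp: Q'_def)
    ultimately have nzQ': "nz Q'" unfolding nz_def by blast
    have iR: "i \<in> R - Q'" using i QR x by (auto simp: Q'_def)
    have other: "\<exists>r\<in>R - Q'. parallel (g x) (g r)" if "card Q \<noteq> 2 * p - 2"
    proof -
      have "card (R - Q) \<ge> 2" using cardRem small that by simp
      then have "card (R - Q - {x}) \<ge> 1" using x R(1) by simp
      then have "R - Q - {x} \<noteq> {}" by (metis card.empty not_one_le_zero)
      then obtain r where "r \<in> R - Q - {x}" by blast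
      then show ?thesis using line by (auto simp: Q'_def)
    qed
    have transfer: "\<not> parallel u (g r)" if "r \<in> R - Q'" "parallel (g x) (g r)" "\<not> parallel u (g x)" for u r
    proof
      assume u: "parallel u (g r)"
      have "parallel (g r) (g x)" using that(2) by (simp only: parallel_sym)
      moreover have "\<not> null (g r)" using that(1) g by blast
      ultimately show False using parallel_trans[OF _ u] that(3) by blast
    qed
    have "card Q = 2 * p - 2 \<or> (\<exists>r\<in>R - Q'. \<exists>r'\<in>R - Q'. \<not> parallel (g r) (g r'))"
    proof (cases "card Q = 2 * p - 2")
      case False
      then obtain r where r: "r \<in> R - Q'" "parallel (g x) (g r)" using other by blast
      have "\<not> parallel (g i) (g x)" using i(2) by (simp add: parallel_sym)
      then have "\<not> parallel (g i) (g r)" using transfer r by blast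
      then show ?thesis using iR r(1) by blast
    qed simp
    then have cQ: "covers g Q'" using cov[OF nzQ' cQ'] by blast
    show thesis
    proof (cases "parallel \<tau> (g i)")
      case False
      then show thesis using finish[OF nzQ' cQ iR] by blast
    next
      case True
      then have tx: "\<not> parallel \<tau> (g x)"
        using i(2) parallel_via_common[OF \<tau>] by blast
      then have "card Q \<noteq> 2 * p - 2" using False x by blast
      then obtain r where "r \<in> R - Q'" "parallel (g x) (g r)" using other by blast
      then show thesis using finish[OF nzQ' cQ] transfer tx by blast
    qed
  qed
qed

section \<open>Growth of sets of residues\<close>

lemma mod_in_range [simp]: "0 \<le> x mod int p" "x mod int p < int p"
  using p_gt_1 by simp_all

lemma inj_on_translate: "A \<subseteq> {0..<int p} \<Longrightarrow> inj_on (\<lambda>w. (w + \<alpha>) mod int p) A"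
proof (rule inj_onI)
  fix x y assume A: "A \<subseteq> {0..<int p}" "x \<in> A" "y \<in> A"
    and eq: "(x + \<alpha>) mod int p = (y + \<alpha>) mod int p"
  then have "[x = y] (mod int p)" by (simp flip: cong_def add: cong_add_rcancel)
  then show "x = y"
    using A cong_less_imp_eq_int[of x "int p" y] by (metis atLeastLessThan_iff subsetD)
qed

lemma closed_under_translation:
  assumes C: "C \<subseteq> {0..<int p}" "C \<noteq> {}" and d: "\<not> int p dvd d"
    and closed: "\<And>x. x \<in> C \<Longrightarrow> (x + d) mod int p \<in> C"
  shows "C = {0..<int p}"
proof
  obtain x where x: "x \<in> C" using C by blast
  have orbit: "(x + int n * d) mod int p \<in> C" for n
  proof (induction n)
    case 0
    then show ?case using x C by auto
  next
    case (Suc n)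
    have "((x + int n * d) mod int p + d) mod int p = (x + int (Suc n) * d) mod int p"
      unfolding mod_add_left_eq by (simp add: algebra_simps)
    then show ?case using closed[OF Suc] by simp
  qed
  show "{0..<int p} \<subseteq> C"
  proof
    fix t assume t: "t \<in> {0..<int p}"
    obtain n :: nat where "[int n * d = t - x] (mod int p)"
      using solve_linear_mod[OF d] by blast
    then have "[x + int n * d = x + (t - x)] (mod int p)" by (intro cong_add cong_refl)
    then have "(x + int n * d) mod int p = t" using t by (simp add: cong_def)
    then show "t \<in> C" using orbit[of n] by simp
  qed
qed (rule C)

text \<open>
  Sumset growth in its simplest form: if \<open>C\<close> were no larger than \<open>A\<close>, both translates of \<open>A\<close> would
  fill it, so \<open>C\<close> would be invariant under the nonzero translation by \<open>\<beta> - \<alpha>\<close> and be everything.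
\<close>

lemma card_two_translates:
  assumes A: "A \<subseteq> {0..<int p}" "A \<noteq> {}" and C: "C \<subseteq> {0..<int p}"
    and sub: "\<And>w. w \<in> A \<Longrightarrow> (w + \<alpha>) mod int p \<in> C" "\<And>w. w \<in> A \<Longrightarrow> (w + \<beta>) mod int p \<in> C"
    and ne: "\<not> [\<alpha> = \<beta>] (mod int p)"
  shows "min p (card A + 1) \<le> card C"
proof (rule ccontr)
  assume "\<not> ?thesis"
  then have less: "card C < p" "card C \<le> card A" by auto
  have finC: "finite C" using C finite_subset by blast
  have fill: "(\<lambda>w. (w + \<gamma>) mod int p) ` A = C"
    if "\<And>w. w \<in> A \<Longrightarrow> (w + \<gamma>) mod int p \<in> C" for \<gamma>
    using that less(2) card_image[OF inj_on_translate[OF A(1)], of \<gamma>]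
    by (intro card_seteq[OF finC]) auto
  have "C = {0..<int p}"
  proof (rule closed_under_translation[OF C])
    show "C \<noteq> {}" using A(2) sub by blast
    show "\<not> int p dvd \<beta> - \<alpha>" using ne by (simp add: cong_iff_dvd_diff dvd_diff_commute)
    fix x assume "x \<in> C"
    then obtain w where w: "w \<in> A" "x = (w + \<alpha>) mod int p"
      using fill[OF sub(1)] by blast
    then have "(x + (\<beta> - \<alpha>)) mod int p = (w + \<beta>) mod int p"
      by (simp add: mod_add_left_eq)
    then show "(x + (\<beta> - \<alpha>)) mod int p \<in> C" using sub(2)[OF w(1)] by simp
  qed
  then show False using less by simp
qed

text \<open>
  Each nonzero summand enlarges the set of subset sums by at least one residue.
\<close>

lemma subset_sums_cover:
  assumes "finite J" "\<And>i. i \<in> J \<Longrightarrow> \<not> int p dvd f i" "card J \<ge> p - 1"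
  obtains X where "X \<subseteq> J" "[sum f X = t] (mod int p)"
proof -
  define S where "S J = (\<lambda>X. sum f X mod int p) ` Pow J" for J
  have "min p (card J + 1) \<le> card (S J)" using assms(1,2)
  proof (induction J rule: finite_induct)
    case empty
    then show ?case by (simp add: S_def)
  next
    case (insert j J)
    have "min p (card (S J) + 1) \<le> card (S (insert j J))"
    proof (rule card_two_translates[where \<alpha> = 0 and \<beta> = "f j"])
      fix w assume "w \<in> S J"
      then obtain X where X: "X \<subseteq> J" "w = sum f X mod int p" by (auto simp: S_def)
      have "X \<in> Pow (insert j J)" "insert j X \<in> Pow (insert j J)" using X by auto
      note mem = this[THEN imageI, of "\<lambda>X. sum f X mod int p"]
      show "(w + 0) mod int p \<in> S (insert j J)" using mem(1) X by (simp add: S_def)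
      have "finite X" "j \<notin> X" using X insert finite_subset by auto
      then have "(w + f j) mod int p = sum f (insert j X) mod int p"
        unfolding X(2) mod_add_left_eq by (simp add: add.commute)
      then show "(w + f j) mod int p \<in> S (insert j J)" using mem(2) by (simp only: S_def)
    next
      show "\<not> [0 = f j] (mod int p)" using insert.prems by (simp add: cong_iff_dvd_diff)
    qed (auto simp: S_def)
    moreover have "min p (card J + 1) \<le> card (S J)" using insert by simp
    ultimately show ?case using insert by simp
  qed
  then have "p \<le> card (S J)" using assms(3) by simp
  moreover have sub: "S J \<subseteq> {0..<int p}" by (auto simp: S_def)
  ultimately have "S J = {0..<int p}" by (intro card_seteq) simp_all
  then have "t mod int p \<in> S J" by simp
  then obtain X where "X \<subseteq> J" "t mod int p = sum f X mod int p" unfolding S_def by blast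
  then show thesis by (intro that) (simp_all add: cong_def)
qed

section \<open>Heights of the orderings of a set of terms\<close>

text \<open>
  The corner entry of the product, in the order of the list, of the unitriangular matrices with
  first superdiagonal \<open>g i\<close> and corner entry \<open>c i\<close>.
\<close>

fun height :: "('i \<Rightarrow> int \<times> int) \<Rightarrow> ('i \<Rightarrow> int) \<Rightarrow> 'i list \<Rightarrow> int" where
  "height g c [] = 0"
| "height g c (i # xs) = c i + fst (g i) * snd (sum_list (map g xs)) + height g c xs"

lemma height_append:
  "height g c (xs @ ys) = height g c xs + height g c ys
     + fst (sum_list (map g xs)) * snd (sum_list (map g ys))"
  by (induction xs) (simp_all add: algebra_simps)

definition heights :: "('i \<Rightarrow> int \<times> int) \<Rightarrow> ('i \<Rightarrow> int) \<Rightarrow> 'i set \<Rightarrow> int set" where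
  "heights g c B = {height g c xs mod int p | xs. distinct xs \<and> set xs = B}"

lemma heights_range: "heights g c B \<subseteq> {0..<int p}"
  by (auto simp: heights_def)

lemma heights_nonempty:
  assumes "finite B"
  shows "heights g c B \<noteq> {}"
proof -
  obtain xs where "set xs = B" "distinct xs" using finite_distinct_list[OF assms] by blast
  then have "height g c xs mod int p \<in> heights g c B" unfolding heights_def by blast
  then show ?thesis by blast
qed

lemma card_heights_pos: "finite B \<Longrightarrow> card (heights g c B) \<ge> 1"
  using heights_nonempty[of B g c] finite_subset[OF heights_range, of g c B]
  by (simp add: Suc_le_eq card_gt_0_iff)

text \<open>
  A block of new terms placed before or after an ordering of \<open>B\<close> shifts its height by an amount that
  does not depend on the ordering.
\<close>

lemma heights_prefix:
  assumes "distinct ys" "set ys \<inter> B = {}" "w \<in> heights g c B"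
  shows "(w + (height g c ys + fst (sum g (set ys)) * snd (sum g B))) mod int p
    \<in> heights g c (set ys \<union> B)"
proof -
  obtain xs where xs: "distinct xs" "set xs = B" "w = height g c xs mod int p"
    using assms(3) by (auto simp: heights_def)
  have "height g c (ys @ xs) = height g c xs
      + (height g c ys + fst (sum g (set ys)) * snd (sum g B))"
    using xs assms(1) by (simp add: height_append sum_list_distinct_conv_sum_set)
  moreover have "distinct (ys @ xs)" "set (ys @ xs) = set ys \<union> B" using xs assms by auto
  ultimately show ?thesis
    unfolding heights_def xs(3) mod_add_left_eq mem_Collect_eq
    by (intro exI[of _ "ys @ xs"] conjI) simp_all
qed

lemma heights_suffix:
  assumes "distinct ys" "set ys \<inter> B = {}" "w \<in> heights g c B"
  shows "(w + (height g c ys + fst (sum g B) * snd (sum g (set ys)))) mod int p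
    \<in> heights g c (set ys \<union> B)"
proof -
  obtain xs where xs: "distinct xs" "set xs = B" "w = height g c xs mod int p"
    using assms(3) by (auto simp: heights_def)
  have "height g c (xs @ ys) = height g c xs
      + (height g c ys + fst (sum g B) * snd (sum g (set ys)))"
    using xs assms(1) by (simp add: height_append sum_list_distinct_conv_sum_set)
  moreover have "distinct (xs @ ys)" "set (xs @ ys) = set ys \<union> B" using xs assms by auto
  ultimately show ?thesis
    unfolding heights_def xs(3) mod_add_left_eq mem_Collect_eq
    by (intro exI[of _ "xs @ ys"] conjI) simp_all
qed

text \<open>
  The two shifts, for the new term in first and in last place, differ by a determinant.  This is the
  commutator of the new term with the product over \<open>B\<close>.
\<close>

lemma card_heights_insert:
  assumes "finite B" "y \<notin> B" "\<not> parallel (sum g B) (g y)"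
  shows "min p (card (heights g c B) + 1) \<le> card (heights g c (insert y B))"
proof (rule card_two_translates[where
      \<alpha> = "c y + fst (g y) * snd (sum g B)" and \<beta> = "c y + fst (sum g B) * snd (g y)"])
  fix w assume w: "w \<in> heights g c B"
  show "(w + (c y + fst (g y) * snd (sum g B))) mod int p \<in> heights g c (insert y B)"
    using heights_prefix[of "[y]" B w g c] w assms by simp
  show "(w + (c y + fst (sum g B) * snd (g y))) mod int p \<in> heights g c (insert y B)"
    using heights_suffix[of "[y]" B w g c] w assms by simp
next
  have "(c y + fst (sum g B) * snd (g y)) - (c y + fst (g y) * snd (sum g B)) = det (sum g B) (g y)"
    by (simp add: det_def)
  then show "\<not> [c y + fst (g y) * snd (sum g B) = c y + fst (sum g B) * snd (g y)] (mod int p)"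
    using assms(3) by (subst cong_sym_eq) (simp only: cong_iff_dvd_diff parallel_def simp_thms)
  show "heights g c B \<noteq> {}" using assms(1) by (rule heights_nonempty)
qed (rule heights_range)+

lemma card_heights_mono:
  assumes "finite B" "finite X" "X \<inter> B = {}"
  shows "card (heights g c B) \<le> card (heights g c (B \<union> X))"
proof -
  obtain ys where ys: "distinct ys" "set ys = X" using finite_distinct_list assms(2) by blast
  define \<gamma> where "\<gamma> = height g c ys + fst (sum g X) * snd (sum g B)"
  have "(\<lambda>w. (w + \<gamma>) mod int p) ` heights g c B \<subseteq> heights g c (B \<union> X)"
    using heights_prefix[OF ys(1), of B] ys(2) assms(3) by (auto simp: \<gamma>_def Un_commute)
  then have "card ((\<lambda>w. (w + \<gamma>) mod int p) ` heights g c B) \<le> card (heights g c (B \<union> X))"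
    using finite_subset[OF heights_range] by (intro card_mono) auto
  then show ?thesis by (simp add: card_image inj_on_translate heights_range)
qed

text \<open>
  A central term is either left out or shifts the height by its own nonzero corner entry.
\<close>

lemma card_heights_null:
  assumes "finite B" "finite C" "B \<inter> C = {}"
    and C: "\<And>y. y \<in> C \<Longrightarrow> null (g y) \<and> \<not> int p dvd c y"
  shows "min p (card (heights g c B) + card C) \<le> card (\<Union>Y\<in>Pow C. heights g c (B \<union> Y))"
  using assms(2,3) C
proof (induction C rule: finite_induct)
  case empty
  then show ?case by simp
next
  case (insert y C)
  let ?V = "\<lambda>C. \<Union>Y\<in>Pow C. heights g c (B \<union> Y)"
  have "min p (card (?V C) + 1) \<le> card (?V (insert y C))"
  proof (rule card_two_translates[where \<alpha> = 0 and \<beta> = "c y"])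
    have "heights g c (B \<union> {}) \<subseteq> ?V C" by blast
    then show "?V C \<noteq> {}" using heights_nonempty[OF assms(1), of g c] by auto
    fix w assume "w \<in> ?V C"
    then obtain Y where Y: "Y \<subseteq> C" "w \<in> heights g c (B \<union> Y)" by blast
    then have "(w + 0) mod int p = w" using heights_range[of g c "B \<union> Y"] by auto
    moreover have "Y \<in> Pow (insert y C)" using Y by auto
    ultimately show "(w + 0) mod int p \<in> ?V (insert y C)" using Y(2) by auto
    have "y \<notin> B \<union> Y" using insert Y by auto
    then have "(w + (c y + fst (g y) * snd (sum g (B \<union> Y)))) mod int p
        \<in> heights g c (B \<union> insert y Y)"
      using heights_prefix[of "[y]" "B \<union> Y" w g c] Y by simp
    moreover have "[w + (c y + fst (g y) * snd (sum g (B \<union> Y))) = w + (c y + 0)] (mod int p)"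
      using insert.prems by (intro cong_add cong_refl) (simp add: cong_0_iff null_def)
    ultimately have "(w + c y) mod int p \<in> heights g c (B \<union> insert y Y)"
      by (simp add: cong_def)
    moreover have "insert y Y \<in> Pow (insert y C)" using Y by auto
    ultimately show "(w + c y) mod int p \<in> ?V (insert y C)" by blast
  next
    show "\<not> [0 = c y] (mod int p)" using insert.prems by (simp add: cong_iff_dvd_diff)
    show "?V C \<subseteq> {0..<int p}" "?V (insert y C) \<subseteq> {0..<int p}" using heights_range by blast+
  qed
  moreover have "min p (card (heights g c B) + card C) \<le> card (?V C)"
    using insert by simp
  ultimately show ?case using insert.hyps by simp
qed

text \<open>
  In the coordinate \<open>2 c - a b\<close> of a matrix with superdiagonal \<open>(a, b)\<close> and corner \<open>c\<close>, the
  multiplication becomes addition up to a determinant; this is twice the logarithm.  Hence commuting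
  matrices simply add.
\<close>

lemma double_height_parallel:
  fixes g :: "'i \<Rightarrow> int \<times> int"
  assumes "\<And>i j. i \<in> set xs \<Longrightarrow> j \<in> set xs \<Longrightarrow> parallel (g i) (g j)"
  shows "[2 * height g c xs = (\<Sum>i\<leftarrow>xs. 2 * c i - fst (g i) * snd (g i))
    + fst (sum_list (map g xs)) * snd (sum_list (map g xs))] (mod int p)"
  using assms
proof (induction xs)
  case Nil
  then show ?case by simp
next
  case (Cons i xs)
  let ?S = "sum_list (map g xs)"
  have d: "det (g i) ?S = (\<Sum>j\<leftarrow>xs. det (g i) (g j))"
    by (induction xs) (simp_all add: det_add_right)
  have dvd_sum_list: "int p dvd (\<Sum>j\<leftarrow>ys. f j)" if "\<And>j. j \<in> set ys \<Longrightarrow> int p dvd f j"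
    for ys :: "'i list" and f
    using that by (induction ys) auto
  have "int p dvd (\<Sum>j\<leftarrow>xs. det (g i) (g j))"
    by (rule dvd_sum_list) (use Cons.prems in \<open>auto simp: parallel_def\<close>)
  then have par: "int p dvd det (g i) ?S" by (simp add: d)
  have IH: "int p dvd 2 * height g c xs
      - ((\<Sum>i\<leftarrow>xs. 2 * c i - fst (g i) * snd (g i)) + fst ?S * snd ?S)"
    unfolding cong_iff_dvd_diff[symmetric] by (rule Cons.IH) (use Cons.prems in auto)
  have "2 * height g c (i # xs) - ((\<Sum>i\<leftarrow>i # xs. 2 * c i - fst (g i) * snd (g i))
      + fst (sum_list (map g (i # xs))) * snd (sum_list (map g (i # xs))))
    = (2 * height g c xs - ((\<Sum>i\<leftarrow>xs. 2 * c i - fst (g i) * snd (g i)) + fst ?S * snd ?S))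
      + det (g i) ?S"
    by (simp add: det_def algebra_simps)
  then show ?case
    unfolding cong_iff_dvd_diff using dvd_add[OF IH par] by (simp only:)
qed

text \<open>
  Pairwise commuting terms lie in an abelian group of order \<open>p\<^sup>2\<close>, on which a linear functional that
  does not vanish on the common line, together with the coordinate \<open>2 c - a b\<close>, are additive
  coordinates.  So Olson's theorem for the plane applies; \<open>p\<close> is odd in order to divide by \<open>2\<close>.
\<close>

lemma commuting_zero_height:
  assumes "odd p" "finite M" "card M \<ge> 2 * p - 1"
    and par: "\<And>i j. i \<in> M \<Longrightarrow> j \<in> M \<Longrightarrow> parallel (g i) (g j)"
  obtains X where "X \<subseteq> M" "X \<noteq> {}" "null (sum g X)" "0 \<in> heights g c X"
proof -
  define h where "h i = 2 * c i - fst (g i) * snd (g i)" for i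
  have "\<exists>X\<subseteq>M. X \<noteq> {} \<and> null (sum g X) \<and> int p dvd sum h X"
  proof (cases "\<exists>i\<in>M. \<not> null (g i)")
    case True
    then obtain x where x: "x \<in> M" "\<not> null (g x)" by blast
    obtain y where y: "\<not> int p dvd det y (g x)" using ex_not_parallel[OF x(2)] .
    obtain X where X: "X \<subseteq> M" "X \<noteq> {}" "null (\<Sum>i\<in>X. (det y (g i), h i))"
      using zero_sum_subset[OF assms(2,3)] .
    have "int p dvd det y (sum g X)"
      using X(3) by (simp add: null_def fst_sum det_sum_right)
    moreover have "int p dvd det (g x) (sum g X)"
      unfolding det_sum_right using par x X(1) by (intro dvd_sum) (auto simp: parallel_def)
    ultimately have "null (sum g X)"
      using null_if_parallel_both[of y "g x"] y by (simp add: parallel_def)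
    then show ?thesis using X by (auto simp: null_def snd_sum)
  next
    case False
    obtain X where X: "X \<subseteq> M" "X \<noteq> {}" "null (\<Sum>i\<in>X. (0, h i))"
      using zero_sum_subset[OF assms(2,3)] .
    have "null (sum g X)" using False X(1)
      by (auto simp: null_def fst_sum snd_sum intro!: dvd_sum)
    then show ?thesis using X by (auto simp: null_def snd_sum)
  qed
  then obtain X where X: "X \<subseteq> M" "X \<noteq> {}" "null (sum g X)" "int p dvd sum h X" by blast
  obtain xs where xs: "distinct xs" "set xs = X"
    using X(1) assms(2) finite_subset finite_distinct_list by metis
  have "[2 * height g c xs = sum h X + fst (sum g X) * snd (sum g X)] (mod int p)"
    using double_height_parallel[of xs g c] par X(1) xs
    by (simp add: sum_list_distinct_conv_sum_set h_def subset_iff)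
  moreover have "int p dvd sum h X + fst (sum g X) * snd (sum g X)"
    using X by (simp add: null_def)
  ultimately have "int p dvd 2 * height g c xs" using cong_dvd_iff by blast
  moreover have "\<not> int p dvd 2"
    using not_dvd_of_nat[of 2] assms(1) p_gt_1 by (cases "p = 2") auto
  ultimately have "int p dvd height g c xs" by (simp add: dvd_mult_iff)
  then have "0 \<in> heights g c X" using xs by (force simp: heights_def)
  then show thesis using that X by blast
qed

end

section \<open>Product-one-free sequences are short\<close>

text \<open>
  The terms of a hypothetical product-one-free sequence of length \<open>3 p - 2\<close>, indexed so that repeated
  terms are kept apart.  The locale turns out to be inconsistent.
\<close>

locale heisenberg_free_terms = prime_modulus +
  fixes g :: "nat \<Rightarrow> int \<times> int" and c :: "nat \<Rightarrow> int" and I :: "nat set"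
  assumes odd_p: "odd p" and finite_I: "finite I" and card_I: "card I = 3 * p - 2"
    and free: "\<And>X. X \<subseteq> I \<Longrightarrow> X \<noteq> {} \<Longrightarrow> null (sum g X) \<Longrightarrow> 0 \<notin> heights g c X"
begin

definition central :: "nat set" where "central = {i \<in> I. null (g i)}"

definition noncentral :: "nat set" where "noncentral = {i \<in> I. \<not> null (g i)}"

definition line :: "nat \<Rightarrow> nat set" where "line x = {i \<in> noncentral. parallel (g x) (g i)}"

lemma finite_central: "finite central" and finite_noncentral: "finite noncentral" and finite_line: "finite (line x)"
  using finite_I by (simp_all add: central_def noncentral_def line_def)

lemma card_noncentral_central: "card noncentral + card central = 3 * p - 2"
proof -
  have "noncentral \<union> central = I" "noncentral \<inter> central = {}" by (auto simp: central_def noncentral_def)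
  then show ?thesis using card_Un_disjoint[of noncentral central] finite_noncentral finite_central card_I by simp
qed

lemma null_sum: "(\<And>i. i \<in> X \<Longrightarrow> null (g i)) \<Longrightarrow> null (sum g X)"
  by (auto simp: null_def fst_sum snd_sum intro!: dvd_sum)

text \<open>
  Otherwise \<open>B\<close> together with the central terms in \<open>C\<close> reaches every residue as a height, in
  particular \<open>0\<close>.
\<close>

lemma heights_not_all:
  assumes B: "B \<subseteq> I" "B \<noteq> {}" "null (sum g B)"
    and C: "C \<subseteq> central" "B \<inter> C = {}" "\<And>y. y \<in> C \<Longrightarrow> \<not> int p dvd c y"
  shows "card (heights g c B) + card C < p"
proof (rule ccontr)
  assume large: "\<not> ?thesis"
  have finB: "finite B" by (rule finite_subset[OF B(1) finite_I])
  have finC: "finite C" by (rule finite_subset[OF C(1) finite_central])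
  let ?V = "\<Union>Y\<in>Pow C. heights g c (B \<union> Y)"
  have "min p (card (heights g c B) + card C) \<le> card ?V"
    using C by (intro card_heights_null finB finC) (auto simp: central_def)
  then have "p \<le> card ?V" using large by linarith
  moreover have "?V \<subseteq> {0..<int p}" using heights_range by blast
  ultimately have "?V = {0..<int p}" by (intro card_seteq) simp_all
  moreover have "0 \<in> {0..<int p}" using p_gt_1 by simp
  ultimately have "0 \<in> ?V" by (simp only:)
  then obtain Y where Y: "Y \<subseteq> C" "0 \<in> heights g c (B \<union> Y)" by blast
  have "finite Y" using Y(1) finC by (rule finite_subset)
  moreover have "B \<inter> Y = {}" using C(2) Y(1) by blast
  ultimately have "sum g (B \<union> Y) = sum g B + sum g Y"
    using finB by (intro sum.union_disjoint)
  moreover have "null (sum g Y)" using Y C by (intro null_sum) (auto simp: central_def)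
  ultimately have "null (sum g (B \<union> Y))" using null_add B(3) by simp
  moreover have "Y \<subseteq> I" using Y C by (auto simp: central_def)
  then have "B \<union> Y \<subseteq> I" "B \<union> Y \<noteq> {}" using B by auto
  ultimately show False using free[of "B \<union> Y"] Y(2) by simp
qed

lemma central_height:
  assumes "y \<in> central"
  shows "\<not> int p dvd c y"
proof
  assume "int p dvd c y"
  then have "height g c [y] mod int p = 0" by simp
  then have "0 \<in> heights g c {y}"
    unfolding heights_def mem_Collect_eq by (intro exI[of _ "[y]"]) simp
  then show False using free[of "{y}"] assms by (simp add: central_def)
qed

lemma card_central: "card central < p"
proof (cases "central = {}")
  case True
  then show ?thesis using p_gt_1 by simp
next
  case False
  then obtain y where y: "y \<in> central" by blast
  have "card (heights g c {y}) + card (central - {y}) < p"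
    using y central_height by (intro heights_not_all) (auto simp: central_def)
  moreover have "card (heights g c {y}) \<ge> 1" by (rule card_heights_pos) simp
  ultimately show ?thesis using card_Suc_Diff1[OF finite_central y] by simp
qed

text \<open>
  Completing \<open>B\<close> to a set with sum zero does not lose heights, whatever the completion \<open>X\<close> is.
\<close>

lemma few_heights:
  assumes "B \<subseteq> noncentral" "B \<noteq> {}" "X \<subseteq> noncentral" "X \<inter> B = {}" "null (sum g (B \<union> X))"
  shows "card (heights g c B) + card central < p"
proof -
  have fin: "finite B" "finite X" using assms(1,3) finite_subset[OF _ finite_noncentral] by simp_all
  have "card (heights g c (B \<union> X)) + card central < p"
    using assms central_height by (intro heights_not_all) (auto simp: noncentral_def central_def)
  then show ?thesis using card_heights_mono[OF fin assms(4), of g c] by simp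
qed

lemma line_parallel:
  assumes "x \<in> noncentral" "i \<in> line x" "j \<in> line x"
  shows "parallel (g i) (g j)"
  using assms parallel_via_common[of "g x"] by (simp add: line_def noncentral_def)

text \<open>
  The terms on a line and the central terms commute pairwise.
\<close>

lemma card_line:
  assumes "x \<in> noncentral"
  shows "card (line x) + card central < 2 * p - 1"
proof (rule ccontr)
  assume *: "\<not> ?thesis"
  have "line x \<inter> central = {}" by (auto simp: line_def noncentral_def central_def)
  then have "card (line x \<union> central) = card (line x) + card central"
    using finite_line finite_central by (simp add: card_Un_disjoint)
  then have "card (line x \<union> central) \<ge> 2 * p - 1" using * by simp
  moreover have "parallel (g i) (g j)" if "i \<in> line x \<union> central" "j \<in> line x \<union> central" for i j
  proof -
    have "parallel (g i) (g j)" if "i \<in> central \<or> j \<in> central"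
      using that null_imp_parallel[of "g i" "g j"] null_imp_parallel[of "g j" "g i"]
      by (auto simp: central_def parallel_sym[of "g i" "g j"])
    then show ?thesis using that line_parallel[OF assms] by blast
  qed
  moreover have "finite (line x \<union> central)" using finite_line finite_central by simp
  ultimately obtain X where X: "X \<subseteq> line x \<union> central" "X \<noteq> {}" "null (sum g X)" "0 \<in> heights g c X"
    using commuting_zero_height[OF odd_p, of "line x \<union> central" g c] by blast
  have "line x \<union> central \<subseteq> I" by (auto simp: line_def noncentral_def central_def)
  then show False using free X by blast
qed

text \<open>
  If all of the at least \<open>p\<close> vectors outside \<open>B\<close> were parallel to \<open>\<tau>\<close>, they would share a line.
\<close>

lemma ex_not_parallel_outside:
  assumes light: "\<And>x. x \<in> A \<Longrightarrow> card {i \<in> A. parallel (g x) (g i)} < p"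
    and A: "finite A" and B: "B \<subseteq> A" "card B + p \<le> card A" and \<tau>: "\<not> null \<tau>"
  obtains i where "i \<in> A - B" "\<not> parallel \<tau> (g i)"
proof -
  have "card (A - B) = card A - card B" using finite_subset[OF B(1) A] B(1) by (rule card_Diff_subset)
  then have large: "card (A - B) \<ge> p" using B by simp
  then have "card (A - B) \<noteq> 0" using p_gt_1 by linarith
  then have "A - B \<noteq> {}" by (metis card.empty)
  then obtain x where x: "x \<in> A - B" by blast
  have "\<not> (\<forall>i\<in>A - B. parallel \<tau> (g i))"
  proof
    assume all: "\<forall>i\<in>A - B. parallel \<tau> (g i)"
    then have "A - B \<subseteq> {i \<in> A. parallel (g x) (g i)}"
      using x parallel_via_common[OF \<tau>] by blast
    then have "card (A - B) \<le> card {i \<in> A. parallel (g x) (g i)}"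
      using A by (intro card_mono) simp_all
    then show False using light[of x] x large by simp
  qed
  then show thesis using that by blast
qed

text \<open>
  Greedy growth: the next term is taken not parallel to the current sum, which gives a new height
  and keeps the sum nonzero.
\<close>

lemma light_lines_chain:
  assumes light: "\<And>x. x \<in> noncentral \<Longrightarrow> card (line x) < p" and n: "1 \<le> n" "n + card central < p"
  shows "\<exists>B\<subseteq>noncentral. card B = n \<and> n \<le> card (heights g c B) \<and> \<not> null (sum g B)"
  using n
proof (induction n rule: dec_induct)
  case base
  have "noncentral \<noteq> {}" using card_noncentral_central card_central p_gt_1 by auto
  then obtain i where "i \<in> noncentral" by blast
  then show ?case
    using card_heights_pos[of "{i}" g c] by (intro exI[of _ "{i}"]) (simp add: noncentral_def)
next
  case (step n)
  then obtain B where B: "B \<subseteq> noncentral" "card B = n" "n \<le> card (heights g c B)" "\<not> null (sum g B)"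
    by auto
  have finB: "finite B" by (rule finite_subset[OF B(1) finite_noncentral])
  have "card B + p \<le> card noncentral" using card_noncentral_central B step by simp
  then obtain i where i: "i \<in> noncentral - B" "\<not> parallel (sum g B) (g i)"
    using ex_not_parallel_outside[OF _ finite_noncentral B(1) _ B(4)] light by (auto simp: line_def)
  have "min p (card (heights g c B) + 1) \<le> card (heights g c (insert i B))"
    using i finB by (intro card_heights_insert) auto
  moreover have "\<not> null (sum g (insert i B))"
    using add_not_null[OF i(2)] i finB by (simp add: add.commute)
  ultimately show ?case
    using i B finB step by (intro exI[of _ "insert i B"]) auto
qed

text \<open>
  With \<open>s = p - 1 - card central\<close> there are \<open>2 p - 1 + s\<close> noncentral terms.  If all lines are light,
  a greedy set \<open>B\<close> of \<open>s\<close> terms leaves \<open>2 p - 1\<close>, and \<open>ex_covering_complement\<close> splits off a term that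
  yields the missing height while the other \<open>2 p - 2\<close> still cover the plane.
\<close>

lemma some_line_heavy: "\<exists>x\<in>noncentral. p \<le> card (line x)"
proof (rule ccontr)
  assume "\<not> ?thesis"
  then have light: "\<And>x. x \<in> noncentral \<Longrightarrow> card (line x) < p" by (meson not_le)
  define s where "s = p - 1 - card central"
  have s: "s + card central + 1 = p" using card_central by (simp add: s_def)
  \<comment> \<open>For \<open>s = 0\<close> the set \<open>B\<close> is empty, its sum is zero, and any nonzero \<open>\<tau>\<close> serves as direction.\<close>
  obtain B \<tau> where B: "B \<subseteq> noncentral" "card B = s" and \<tau>: "\<not> null \<tau>"
    and grow: "\<And>r. r \<in> noncentral - B \<Longrightarrow> \<not> parallel \<tau> (g r) \<Longrightarrow> s + 1 \<le> card (heights g c (insert r B))"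
  proof (cases "s = 0")
    case True
    have "\<not> null (1, 0)" using p_gt_1 by (simp add: null_def)
    moreover have "1 \<le> card (heights g c {r})" for r by (rule card_heights_pos) simp
    ultimately show thesis using True that[of "{}" "(1, 0)"] by simp
  next
    case False
    then obtain B where B: "B \<subseteq> noncentral" "card B = s" "s \<le> card (heights g c B)" "\<not> null (sum g B)"
      using light_lines_chain[OF light, of s] s by auto
    have finB: "finite B" by (rule finite_subset[OF B(1) finite_noncentral])
    have "s + 1 \<le> card (heights g c (insert r B))"
      if "r \<in> noncentral - B" "\<not> parallel (sum g B) (g r)" for r
      using card_heights_insert[OF finB _ that(2), of c] that B(3) s by simp
    then show thesis using B that[of B "sum g B"] by blast
  qed
  have finB: "finite B" by (rule finite_subset[OF B(1) finite_noncentral])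
  have "card (noncentral - B) = card noncentral - card B" using B(1) finB by (rule card_Diff_subset[rotated])
  then have R: "finite (noncentral - B)" "card (noncentral - B) = 2 * p - 1"
    using finite_noncentral B card_noncentral_central s by simp_all
  have "card {j \<in> noncentral - B. parallel (g i) (g j)} < p" if "i \<in> noncentral - B" for i
  proof -
    have "card {j \<in> noncentral - B. parallel (g i) (g j)} \<le> card (line i)"
      using finite_line by (intro card_mono) (auto simp: line_def)
    then show ?thesis using light[of i] that by simp
  qed
  moreover have "\<not> null (g i)" if "i \<in> noncentral - B" for i using that by (simp add: noncentral_def)
  ultimately obtain r where r: "r \<in> noncentral - B" "\<not> parallel \<tau> (g r)" "covers g (noncentral - B - {r})"
    using ex_covering_complement[OF R, of g \<tau>] \<tau> by blast
  obtain X where X: "X \<subseteq> noncentral - B - {r}" "null (sum g X - (- sum g (insert r B)))"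
    using r(3) unfolding covers_def by blast
  have finX: "finite X" using X(1) by (intro finite_subset[OF _ finite_noncentral]) auto
  have "sum g (insert r B \<union> X) = sum g (insert r B) + sum g X"
    using X(1) finB finX by (intro sum.union_disjoint) auto
  then have "null (sum g (insert r B \<union> X))" using X(2) by (simp add: add.commute)
  moreover have "insert r B \<subseteq> noncentral" "X \<subseteq> noncentral" "X \<inter> insert r B = {}" using r B X by auto
  ultimately have "card (heights g c (insert r B)) + card central < p"
    by (intro few_heights[of _ X]) auto
  then show False using grow[OF r(1,2)] s by simp
qed

lemma parallel_sum: "(\<And>i. i \<in> X \<Longrightarrow> parallel u (g i)) \<Longrightarrow> parallel u (sum g X)"
  unfolding parallel_def det_sum_right by (rule dvd_sum)

text \<open>
  If exchanging one element of \<open>U\<close> for \<open>y\<close> never changed the sum, all vectors involved would equal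
  \<open>g y\<close>, and the sum would be \<open>m\<close> times this nonzero vector.
\<close>

lemma ex_subset_line_sum:
  assumes x: "x \<in> noncentral" and m: "0 < m" "m < p" "m < card (line x)"
  obtains U where "U \<subseteq> line x" "card U = m" "\<not> null (sum g U)"
proof -
  obtain U where U: "U \<subseteq> line x" "card U = m" "finite U"
    using obtain_subset_with_card_n[of m "line x"] m by auto
  have "line x - U \<noteq> {}"
  proof
    assume "line x - U = {}"
    then have "card (line x) \<le> card U" using U(3) by (intro card_mono) auto
    then show False using m U by simp
  qed
  then obtain y where y: "y \<in> line x" "y \<notin> U" by blast
  show thesis
  proof (cases "null (sum g U)")
    case False
    then show thesis using that U by blast
  next
    case nullU: True
    have "\<exists>z\<in>U. \<not> null (g y - g z)"
    proof (rule ccontr)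
      assume "\<not> ?thesis"
      then have "null (\<Sum>z\<in>U. g y - g z)"
        by (auto simp: null_def fst_sum snd_sum intro!: dvd_sum)
      moreover have "(\<Sum>z\<in>U. g y - g z) + sum g U = smul (int m) (g y)"
        using U(2) by (simp add: sum_subtractf prod_eq_iff fst_sum snd_sum smul_def)
      ultimately have "null (smul (int m) (g y))" using null_add[OF _ nullU] by metis
      then have "null (g y)"
        using not_dvd_of_nat[OF m(1,2)] by (simp add: null_def smul_def dvd_mult_iff)
      then show False using y(1) by (simp add: line_def noncentral_def)
    qed
    then obtain z where z: "z \<in> U" "\<not> null (g y - g z)" by blast
    let ?U = "insert y (U - {z})"
    have "sum g ?U = (g y - g z) + sum g U"
      using U(3) y z by (simp add: sum_diff1)
    then have "\<not> null (sum g ?U)"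
      using null_add[of "sum g ?U" "- sum g U"] nullU z(2) by (auto simp: null_minus)
    moreover have "card ?U = m" using U y z card_Suc_Diff1[OF U(3) z(1)] by simp
    moreover have "?U \<subseteq> line x" using U y by auto
    ultimately show thesis using that by blast
  qed
qed

text \<open>
  The sum of \<open>v\<close> with vectors of the line stays off the line, so every further element of the line
  gives a new height.
\<close>

lemma card_heights_line_insert:
  assumes x: "x \<in> noncentral" and U: "U \<subseteq> line x" and v: "v \<in> noncentral - line x"
  shows "min p (card U + 1) \<le> card (heights g c (insert v U))"
proof -
  have "finite U" by (rule finite_subset[OF U finite_line])
  then show ?thesis using U
  proof (induction U rule: finite_induct)
    case empty
    then show ?case using card_heights_pos[of "{v}" g c] by simp
  next
    case (insert u U)
    have uN: "u \<in> noncentral" "\<not> null (g u)" "parallel (g x) (g u)"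
      using insert by (auto simp: line_def noncentral_def)
    have "v \<notin> insert u U" using insert v by auto
    have "parallel (g u) (sum g U)"
      using insert.prems line_parallel[OF x] by (intro parallel_sum) auto
    then have "int p dvd det (sum g U) (g u)" by (simp only: parallel_sym flip: parallel_def)
    moreover have "\<not> parallel (g v) (g u)"
    proof
      assume "parallel (g v) (g u)"
      then have "parallel (g u) (g v)" by (simp only: parallel_sym)
      then have "parallel (g x) (g v)" using parallel_trans[OF uN(2,3)] by blast
      then show False using v by (simp add: line_def)
    qed
    moreover have "sum g (insert v U) = g v + sum g U"
      using insert.hyps \<open>v \<notin> insert u U\<close> by simp
    ultimately have "\<not> parallel (sum g (insert v U)) (g u)"
      by (simp add: parallel_def det_add_left dvd_add_left_iff)
    moreover have "u \<notin> insert v U" using insert \<open>v \<notin> insert u U\<close> by auto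
    ultimately have "min p (card (heights g c (insert v U)) + 1)
        \<le> card (heights g c (insert u (insert v U)))"
      using insert.hyps by (intro card_heights_insert) simp_all
    moreover have "min p (card U + 1) \<le> card (heights g c (insert v U))"
      using insert by simp
    ultimately show ?case using insert.hyps by (simp add: insert_commute)
  qed
qed

lemma not_parallel_outside:
  assumes "x \<in> noncentral" "v \<in> noncentral - line x"
  shows "\<not> parallel (g x) (g v)"
  using assms by (simp add: line_def)

text \<open>
  Starting from \<open>U\<close> and one term off the line, further terms off the line are added greedily.  This
  can only get stuck when the terms off the line that remain, at least \<open>p\<close> in number, share a second
  line.  In that case all of \<open>V\<close> is taken from the second line from the outset: the sum over \<open>U\<close> is a
  nonzero vector of the first line, so adding vectors of the second line never makes the total
  parallel to the second line.  The set \<open>P\<close> is the supply of terms in either case.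
\<close>

lemma heavy_line_chain:
  assumes x: "x \<in> noncentral" and U: "U \<subseteq> line x" "\<not> null (sum g U)"
    and n: "1 \<le> n" "n + p \<le> card (noncentral - line x) + 1" "card U + n \<le> p"
  shows "\<exists>V\<subseteq>noncentral - line x. card V = n \<and> card U + n \<le> card (heights g c (U \<union> V))"
proof -
  define Out where "Out = noncentral - line x"
  have finO: "finite Out" using finite_noncentral by (simp add: Out_def)
  have finU: "finite U" by (rule finite_subset[OF U(1) finite_line])
  have xU: "parallel (g x) (sum g U)"
    using U(1) by (intro parallel_sum) (auto simp: line_def)
  have Ov: "\<not> parallel (g x) (g v)" if "v \<in> Out" for v
    using that x not_parallel_outside by (simp add: Out_def)
  obtain P where P: "P \<subseteq> Out" "P \<noteq> {}" and pick:
    "\<And>V. V \<subseteq> P \<Longrightarrow> card V < n \<Longrightarrow> \<not> null (sum g U + sum g V) \<Longrightarrow>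
      \<exists>v\<in>P - V. \<not> parallel (sum g U + sum g V) (g v)"
  proof (cases "\<exists>w\<in>Out. p \<le> card {i \<in> Out. parallel (g w) (g i)}")
    case True
    then obtain w where w: "w \<in> Out" "p \<le> card {i \<in> Out. parallel (g w) (g i)}" by blast
    define P where "P = {i \<in> Out. parallel (g w) (g i)}"
    have wn: "\<not> null (g w)" using w(1) by (simp add: Out_def noncentral_def)
    show thesis
    proof (rule that[of P])
      show "P \<subseteq> Out" "P \<noteq> {}" using w by (auto simp: P_def)
      fix V assume V: "V \<subseteq> P" "card V < n"
      have finP: "finite P" using finO by (simp add: P_def)
      have "\<not> P \<subseteq> V"
      proof
        assume "P \<subseteq> V"
        then have "card P \<le> card V" using V(1) finP finite_subset by (intro card_mono) auto
        then show False using V(2) w(2) n(3) by (simp add: P_def)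
      qed
      then obtain v where v: "v \<in> P - V" by blast
      have "parallel (g v) (sum g V)"
      proof (rule parallel_sum)
        fix i assume "i \<in> V"
        then have "parallel (g w) (g i)" "parallel (g w) (g v)" using V(1) v by (auto simp: P_def)
        then show "parallel (g v) (g i)" using parallel_via_common[OF wn] by blast
      qed
      then have "int p dvd det (sum g V) (g v)" by (simp only: parallel_sym flip: parallel_def)
      moreover have "\<not> parallel (sum g U) (g v)"
      proof
        assume "parallel (sum g U) (g v)"
        then have "parallel (g x) (g v)" by (rule parallel_trans[OF U(2) xU])
        then show False using Ov v by (simp add: P_def)
      qed
      ultimately have "\<not> parallel (sum g U + sum g V) (g v)"
        by (simp add: parallel_def det_add_left dvd_add_left_iff)
      then show "\<exists>v\<in>P - V. \<not> parallel (sum g U + sum g V) (g v)" using v by blast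
    qed
  next
    case False
    show thesis
    proof (rule that[of Out])
      show "Out \<noteq> {}" using n p_gt_1 by (auto simp flip: Out_def)
      fix V assume V: "V \<subseteq> Out" "card V < n" "\<not> null (sum g U + sum g V)"
      have "card V + p \<le> card Out" using V(2) n(2) by (simp add: Out_def)
      then show "\<exists>v\<in>Out - V. \<not> parallel (sum g U + sum g V) (g v)"
        using ex_not_parallel_outside[OF _ finO V(1) _ V(3)] False by (metis not_le)
    qed simp
  qed
  have "\<exists>V\<subseteq>P. card V = k
      \<and> card U + k \<le> card (heights g c (U \<union> V)) \<and> \<not> null (sum g U + sum g V)"
    if "1 \<le> k" "k \<le> n" for k
    using that
  proof (induction k rule: dec_induct)
    case base
    obtain v where v: "v \<in> P" using P by blast
    then have vO: "v \<in> Out" using P by blast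
    have "min p (card U + 1) \<le> card (heights g c (insert v U))"
      using vO by (intro card_heights_line_insert[OF x U(1)]) (simp add: Out_def)
    then have "card U + 1 \<le> card (heights g c (U \<union> {v}))" using n by simp
    moreover have "\<not> null (sum g U + sum g {v})"
    proof
      assume "null (sum g U + sum g {v})"
      then have "int p dvd det (g x) (sum g U + g v)" using null_det_right by simp
      then have "parallel (g x) (g v)"
        using xU by (simp add: parallel_def det_add_right dvd_add_right_iff)
      then show False using Ov vO by blast
    qed
    ultimately show ?case using v by (intro exI[of _ "{v}"]) simp
  next
    case (step k)
    then obtain V where V: "V \<subseteq> P" "card V = k" "card U + k \<le> card (heights g c (U \<union> V))"
      "\<not> null (sum g U + sum g V)" by auto
    have finV: "finite V" using V(1) P(1) finO by (meson finite_subset)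
    have VU: "U \<inter> P = {}" using P(1) U(1) by (auto simp: Out_def)
    then have sum_UV: "sum g (U \<union> V) = sum g U + sum g V"
      using V(1) by (intro sum.union_disjoint finU finV) auto
    obtain v where v: "v \<in> P - V" "\<not> parallel (sum g U + sum g V) (g v)"
      using pick[OF V(1) _ V(4)] V(2) step.prems by auto
    have "min p (card (heights g c (U \<union> V)) + 1) \<le> card (heights g c (insert v (U \<union> V)))"
      using v VU finU finV by (intro card_heights_insert) (auto simp: sum_UV)
    then have "card U + Suc k \<le> card (heights g c (U \<union> insert v V))"
      using V(3) n(3) step.prems by simp
    moreover have "\<not> null (sum g U + sum g (insert v V))"
      using add_not_null[OF v(2)] v(1) finV by (simp add: ac_simps)
    ultimately show ?case
      using v(1) V(1,2) finV by (intro exI[of _ "insert v V"]) auto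
  qed
  from this[OF n(1) order_refl] show ?thesis using P(1) unfolding Out_def by blast
qed

text \<open>
  The line of \<open>x\<close> has \<open>m + (p - 1)\<close> terms and its complement \<open>n + (p - 1)\<close>, where
  \<open>m + n = p - card central\<close> is exactly the number of heights required.  Reserving \<open>p - 1\<close> terms on
  either side, those off the line (\<open>X\<close>) move the total sum onto the line of \<open>x\<close>, and those on the
  line (\<open>Y\<close>) then move it to zero.
\<close>

lemma no_free_terms: False
proof -
  obtain x where x: "x \<in> noncentral" "p \<le> card (line x)" using some_line_heavy by blast
  define Out where "Out = noncentral - line x"
  have line_sub: "line x \<subseteq> noncentral" by (auto simp: line_def)
  have cO: "card Out = card noncentral - card (line x)"
    unfolding Out_def by (rule card_Diff_subset[OF finite_line line_sub])
  have lN: "card (line x) \<le> card noncentral" by (rule card_mono[OF finite_noncentral line_sub])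
  define m where "m = card (line x) - (p - 1)"
  define n where "n = card Out - (p - 1)"
  have "card (line x) + card central < 2 * p - 1" by (rule card_line[OF x(1)])
  then have sizes: "m + n + card central = p" "1 \<le> m" "1 \<le> n" "card (line x) = m + (p - 1)"
    "card Out = n + (p - 1)"
    using x(2) card_noncentral_central cO lN p_gt_1 unfolding m_def n_def by linarith+
  have "0 < m" "m < p" "m < card (line x)" using sizes p_gt_1 by linarith+
  then obtain U where U: "U \<subseteq> line x" "card U = m" "\<not> null (sum g U)"
    by (rule ex_subset_line_sum[OF x(1)])
  obtain V where V: "V \<subseteq> Out" "card V = n" "m + n \<le> card (heights g c (U \<union> V))"
    using heavy_line_chain[OF x(1) U(1,3), of n] sizes U(2) unfolding Out_def by auto
  have finU: "finite U" by (rule finite_subset[OF U(1) finite_line])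
  have finO: "finite Out" using finite_noncentral by (simp add: Out_def)
  have finV: "finite V" by (rule finite_subset[OF V(1) finO])
  obtain v where v: "v \<in> V" using V(2) sizes by fastforce
  have Ov: "\<not> parallel (g x) (g i)" if "i \<in> Out" for i
    using that not_parallel_outside[OF x(1)] by (simp add: Out_def)
  have vx: "\<not> parallel (g v) (g x)" using Ov v V(1) parallel_sym by blast
  let ?B = "U \<union> V"
  have "card (Out - V) = p - 1" using card_Diff_subset[OF finV V(1)] V(2) sizes by simp
  then obtain X where X: "X \<subseteq> Out - V"
    "[(\<Sum>i\<in>X. det (g x) (g i)) = - det (g x) (sum g ?B)] (mod int p)"
    using subset_sums_cover[of "Out - V" "\<lambda>i. det (g x) (g i)" "- det (g x) (sum g ?B)"]
      Ov finO by (auto simp: parallel_def)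
  have "card (line x - U) = p - 1" using card_Diff_subset[OF finU U(1)] U(2) sizes by simp
  moreover have "\<not> int p dvd det (g v) (g i)" if i: "i \<in> line x - U" for i
  proof
    assume "int p dvd det (g v) (g i)"
    then have "parallel (g i) (g v)" by (simp only: parallel_sym flip: parallel_def)
    moreover have "parallel (g x) (g i)" "\<not> null (g i)" using i by (auto simp: line_def noncentral_def)
    ultimately have "parallel (g x) (g v)" using parallel_trans by blast
    then show False using Ov v V(1) by blast
  qed
  ultimately obtain Y where Y: "Y \<subseteq> line x - U"
    "[(\<Sum>i\<in>Y. det (g v) (g i)) = - det (g v) (sum g ?B + sum g X)] (mod int p)"
    using subset_sums_cover[of "line x - U" "\<lambda>i. det (g v) (g i)"] finite_line by auto
  have finX: "finite X" using X(1) finO by (meson finite_Diff finite_subset)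
  have finY: "finite Y" using Y(1) finite_line by (meson finite_Diff finite_subset)
  have XY: "X \<inter> Y = {}" "(X \<union> Y) \<inter> ?B = {}"
    using X(1) Y(1) U(1) V(1) by (auto simp: Out_def)
  have sums: "sum g (?B \<union> (X \<union> Y)) = sum g ?B + (sum g X + sum g Y)"
    using XY finU finV finX finY by (subst sum.union_disjoint) (auto simp: sum.union_disjoint)
  have "parallel (g x) (sum g Y)" using Y(1) by (intro parallel_sum) (auto simp: line_def)
  then have "int p dvd (det (g x) (sum g X) - (- det (g x) (sum g ?B))) + det (g x) (sum g Y)"
    using X(2) by (intro dvd_add) (simp_all add: det_sum_right cong_iff_dvd_diff parallel_def)
  then have 1: "parallel (g x) (sum g (?B \<union> (X \<union> Y)))"
    unfolding parallel_def sums det_add_right by (simp add: algebra_simps)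
  have "int p dvd det (g v) (sum g Y) - (- det (g v) (sum g ?B + sum g X))"
    using Y(2) by (simp add: det_sum_right cong_iff_dvd_diff)
  then have 2: "parallel (g v) (sum g (?B \<union> (X \<union> Y)))"
    unfolding parallel_def sums det_add_right by (simp add: algebra_simps)
  have "null (sum g (?B \<union> (X \<union> Y)))" by (rule null_if_parallel_both[OF vx 2 1])
  then have "card (heights g c ?B) + card central < p"
    using U(1) V(1) X(1) Y(1) line_sub v XY by (intro few_heights[of _ "X \<union> Y"]) (auto simp: Out_def)
  then show False using V(3) sizes by simp
qed

end

theorem (in prime_modulus) ex_null_zero_height:
  fixes g :: "nat \<Rightarrow> int \<times> int" and c :: "nat \<Rightarrow> int"
  assumes "odd p" "finite I" "card I \<ge> 3 * p - 2"
  obtains X where "X \<subseteq> I" "X \<noteq> {}" "null (sum g X)" "0 \<in> heights g c X"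
proof (rule ccontr)
  assume none: "\<not> thesis"
  obtain J where J: "J \<subseteq> I" "card J = 3 * p - 2" "finite J"
    using obtain_subset_with_card_n[OF assms(3)] by blast
  have "heisenberg_free_terms p g c J"
  proof unfold_locales
    fix X assume "X \<subseteq> J" "X \<noteq> {}" "null (sum g X)"
    then show "0 \<notin> heights g c X" using none that J(1) by blast
  qed (use assms J in auto)
  then show False by (rule heisenberg_free_terms.no_free_terms)
qed

context prime_modulus
begin

section \<open>The Heisenberg group\<close>

definition heis_elem :: "int \<times> int \<Rightarrow> int \<Rightarrow> int ^ 3 ^ 3" where
  "heis_elem v z = UT3_mat (residue_ring (int p)) (fst v mod int p) (snd v mod int p) (z mod int p)"

lemma UT3_mat_eq_iff:
  "UT3_mat R a b c = UT3_mat R a' b' c' \<longleftrightarrow> a = a' \<and> b = b' \<and> c = c'"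
proof
  assume eq: "UT3_mat R a b c = UT3_mat R a' b' c'"
  have "UT3_mat R a b c $ 1 $ 2 = a" "UT3_mat R a b c $ 2 $ 3 = b" "UT3_mat R a b c $ 1 $ 3 = c" for a b c
    by (simp_all add: UT3_mat_def distinct_3)
  then show "a = a' \<and> b = b' \<and> c = c'" using eq by metis
qed simp

lemma heis_elem_mult: "heis_elem v z \<otimes>\<^bsub>heisenberg p\<^esub> heis_elem v' z' = heis_elem (v + v') (z + z' + fst v * snd v')"
proof -
  interpret residues "int p" "residue_ring (int p)"
    using p_gt_1 by unfold_locales simp_all
  show ?thesis
    unfolding heisenberg_def UT3_def heis_elem_def
    by (simp add: UT3_mat_mult add_cong mult_cong)
qed

lemma heis_elem_one: "\<one>\<^bsub>heisenberg p\<^esub> = heis_elem 0 0"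
  by (simp add: heisenberg_def UT3_def heis_elem_def residue_ring_def)

lemma heis_elem_eq_one_iff: "heis_elem v z = \<one>\<^bsub>heisenberg p\<^esub> \<longleftrightarrow> null v \<and> int p dvd z"
  unfolding heis_elem_one by (auto simp: heis_elem_def UT3_mat_eq_iff null_def dvd_eq_mod_eq_0)

lemma heis_elem_carrier: "heis_elem v z \<in> carrier (heisenberg p)"
proof -
  interpret residues "int p" "residue_ring (int p)"
    using p_gt_1 by unfold_locales simp_all
  show ?thesis unfolding heisenberg_def UT3_def heis_elem_def by auto
qed

lemma carrier_heis_elem:
  assumes "x \<in> carrier (heisenberg p)"
  obtains v z where "x = heis_elem v z"
proof -
  obtain a b c where x: "x = UT3_mat (residue_ring (int p)) a b c"
    and "a \<in> {0..int p - 1}" "b \<in> {0..int p - 1}" "c \<in> {0..int p - 1}"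
    using assms by (auto simp: heisenberg_def UT3_def residue_ring_def)
  then have "x = heis_elem (a, b) c" by (simp add: heis_elem_def)
  then show thesis by (rule that)
qed

lemma foldr_heis_elem:
  "foldr (\<otimes>\<^bsub>heisenberg p\<^esub>) (map (\<lambda>i. heis_elem (g i) (c i)) xs) \<one>\<^bsub>heisenberg p\<^esub>
    = heis_elem (sum_list (map g xs)) (height g c xs)"
  by (induction xs) (simp_all add: heis_elem_one heis_elem_mult ac_simps)

lemma not_product_one_free:
  assumes "odd p" and S: "set_mset S \<subseteq> carrier (heisenberg p)" "size S \<ge> 3 * p - 2"
  shows "\<not> product_one_free (heisenberg p) S"
proof -
  obtain ys where ys: "mset ys = S" using ex_mset by blast
  define n where "n = length ys"
  have "\<exists>v z. ys ! i = heis_elem v z" if "i < n" for i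
  proof -
    have "ys ! i \<in> carrier (heisenberg p)" using S(1) ys that nth_mem[of i ys] by (auto simp: n_def)
    then show ?thesis using carrier_heis_elem by metis
  qed
  then obtain g c where gc: "\<And>i. i < n \<Longrightarrow> ys ! i = heis_elem (g i) (c i)" by metis
  have "card {..<n} \<ge> 3 * p - 2" using S(2) ys by (auto simp: n_def)
  then obtain X where X: "X \<subseteq> {..<n}" "X \<noteq> {}" "null (sum g X)" "0 \<in> heights g c X"
    using ex_null_zero_height[OF assms(1), of "{..<n}" g c] by blast
  obtain xs where xs: "distinct xs" "set xs = X" "height g c xs mod int p = 0"
    using X(4) by (auto simp: heights_def)
  let ?T = "mset (map (\<lambda>i. heis_elem (g i) (c i)) xs)"
  have T: "?T = mset (map ((!) ys) xs)"
    using gc X(1) xs(2) by (intro arg_cong[of _ _ mset] map_cong) auto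
  have "mset_set X \<subseteq># mset_set {0..<n}"
    using X(1) by (intro subset_imp_msubset_mset_set) auto
  then have "mset xs \<subseteq># mset [0..<n]"
    using xs(1,2) by (simp add: mset_set_set[symmetric])
  then have "mset (map ((!) ys) xs) \<subseteq># image_mset ((!) ys) (mset [0..<n])"
    unfolding mset_map by (rule image_mset_subseteq_mono)
  then have "?T \<subseteq># image_mset ((!) ys) (mset [0..<n])" unfolding T .
  also have "image_mset ((!) ys) (mset [0..<n]) = S"
    unfolding ys[symmetric] n_def mset_map[symmetric] by (simp add: map_nth)
  finally have "?T \<subseteq># S" .
  moreover have "?T \<noteq> {#}" using X(2) xs(2) by auto
  moreover have "product_one (heisenberg p) ?T"
    unfolding product_one_def
  proof (intro exI conjI)
    show "foldr (\<otimes>\<^bsub>heisenberg p\<^esub>) (map (\<lambda>i. heis_elem (g i) (c i)) xs) \<one>\<^bsub>heisenberg p\<^esub>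
        = \<one>\<^bsub>heisenberg p\<^esub>"
      unfolding foldr_heis_elem heis_elem_eq_one_iff
    proof
      show "null (sum_list (map g xs))"
        using X(3) xs(1,2) by (simp only: sum_list_distinct_conv_sum_set)
      show "int p dvd height g c xs" using xs(3) by (rule mod_0_imp_dvd)
    qed
  qed simp
  ultimately show ?thesis unfolding product_one_free_def by blast
qed

definition basis_sequence :: "(int ^ 3 ^ 3) multiset" where
  "basis_sequence = replicate_mset (p - 1) (heis_elem (1, 0) 0) + replicate_mset (p - 1) (heis_elem (0, 1) 0)
     + replicate_mset (p - 1) (heis_elem 0 1)"

lemma size_basis_sequence: "size basis_sequence = 3 * p - 3"
  using p_gt_1 by (simp add: basis_sequence_def)

text \<open>
  The coordinates of the quotient by the centre count, modulo \<open>p\<close>, the copies of the first two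
  generators in a subsequence, so a product-one subsequence contains neither.  What is left
  are fewer than \<open>p\<close> copies of the central generator.
\<close>

lemma product_one_free_basis_sequence: "product_one_free (heisenberg p) basis_sequence"
  unfolding product_one_free_def
proof (rule notI, elim exE conjE)
  fix T assume T: "T \<subseteq># basis_sequence" "T \<noteq> {#}" and "product_one (heisenberg p) T"
  then obtain xs where xs: "mset xs = T"
    "foldr (\<otimes>\<^bsub>heisenberg p\<^esub>) xs \<one>\<^bsub>heisenberg p\<^esub> = \<one>\<^bsub>heisenberg p\<^esub>"
    by (auto simp: product_one_def)
  define x y z where "x = heis_elem (1, 0) 0" and "y = heis_elem (0, 1) 0" and "z = heis_elem 0 1"
  have ne: "x \<noteq> y" "x \<noteq> z" "y \<noteq> z"
    using p_gt_1 by (auto simp: x_def y_def z_def heis_elem_def UT3_mat_eq_iff)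
  define g :: "int ^ 3 ^ 3 \<Rightarrow> int \<times> int" where
    "g u = (if u = x then (1, 0) else if u = y then (0, 1) else 0)" for u
  define c :: "int ^ 3 ^ 3 \<Rightarrow> int" where "c u = (if u = z then 1 else 0)" for u
  have "set xs \<subseteq> set_mset basis_sequence" using T(1) xs(1) by (metis set_mset_mono set_mset_mset)
  then have sub: "set xs \<subseteq> {x, y, z}"
    by (auto simp: basis_sequence_def x_def y_def z_def split: if_splits)
  have id: "u = heis_elem (g u) (c u)" if "u \<in> {x, y, z}" for u
    using that ne by (auto simp: g_def c_def x_def[symmetric] y_def[symmetric] z_def[symmetric])
  have "map (\<lambda>u. heis_elem (g u) (c u)) xs = map (\<lambda>u. u) xs"
    using sub id by (intro map_cong) auto
  then have "heis_elem (sum_list (map g xs)) (height g c xs) = \<one>\<^bsub>heisenberg p\<^esub>"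
    using foldr_heis_elem[of g c xs] xs(2) by (simp only: list.map_ident)
  then have one: "null (sum_list (map g xs))" "int p dvd height g c xs"
    by (simp_all only: heis_elem_eq_one_iff)
  have le: "count T x \<le> p - 1" "count T y \<le> p - 1" "count T z \<le> p - 1"
    using mset_subset_eq_count[OF T(1), of x] mset_subset_eq_count[OF T(1), of y]
      mset_subset_eq_count[OF T(1), of z] ne
    by (simp_all add: basis_sequence_def flip: x_def y_def z_def)
  have zero: "n = 0" if n: "n \<le> p - 1" "int p dvd int n" for n
  proof (rule ccontr)
    assume "n \<noteq> 0"
    then have "0 < n" "n < p" using n(1) p_gt_1 by linarith+
    then show False using not_dvd_of_nat n(2) by blast
  qed
  have "sum_list (map g ys) = (int (count (mset ys) x), int (count (mset ys) y))" for ys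
    using ne by (induction ys) (auto simp: g_def prod_eq_iff)
  then have "int p dvd int (count T x)" "int p dvd int (count T y)"
    using one(1) xs(1) by (simp_all add: null_def)
  then have xy: "count T x = 0" "count T y = 0" using le zero by blast+
  have "x \<notin> set xs" "y \<notin> set xs" using xy xs(1) by (metis count_eq_zero_iff set_mset_mset)+
  then have zs: "set xs \<subseteq> {z}" using sub by blast
  have "height g c ys = int (count (mset ys) z)" if "set ys \<subseteq> {z}" for ys
    using that ne by (induction ys) (auto simp: g_def c_def)
  then have "int p dvd int (count T z)" using zs one(2) xs(1) by simp
  then have "count T z = 0" using le zero by blast
  then have "z \<notin> set xs" using xs(1) by (metis count_eq_zero_iff set_mset_mset)
  then have "set xs = {}" using subset_singletonD[OF zs] by auto
  then show False using xs(1) T(2) by simp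
qed

end

theorem theorem6p2:
  fixes p :: nat
  assumes "prime p" and "odd p"
  shows "small_davenport (heisenberg p) = 3 * p - 3"
proof -
  interpret prime_modulus p using assms(1) by unfold_locales
  interpret group "heisenberg p" using p_gt_1 by (rule group_heisenberg)
  let ?D = "{size S | S. set_mset S \<subseteq> carrier (heisenberg p) \<and> product_one_free (heisenberg p) S}"
  show ?thesis
    unfolding small_davenport_def
  proof (rule Max_eqI)
    show "finite ?D" by (rule finite_product_one_free_sizes[OF finite_heisenberg])
    show "k \<le> 3 * p - 3" if "k \<in> ?D" for k
    proof -
      from that obtain S where S: "k = size S" "set_mset S \<subseteq> carrier (heisenberg p)"
        "product_one_free (heisenberg p) S" by blast
      then have "\<not> 3 * p - 2 \<le> size S" using not_product_one_free[OF assms(2)] by blast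
      then show ?thesis using S(1) by simp
    qed
    have "set_mset basis_sequence \<subseteq> carrier (heisenberg p)"
      by (auto simp: basis_sequence_def heis_elem_carrier split: if_splits)
    then show "3 * p - 3 \<in> ?D"
      using product_one_free_basis_sequence size_basis_sequence
      by (intro CollectI exI[of _ basis_sequence]) simp
  qed
qed

end
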